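(* Let $q \in \{2,3\}$, let $\sigma_2 = 2$ and $\sigma_3 = C_0$ (the constant described in the context), and let $t \geq 0$. Then for every $n$, \[\mathrm{ex}_{\mathrm{aff}}(n, \mathbb F_q^t) < q^{\,n - (n-t)/(\sigma_q^t - t)}.\] Moreover, if $A \subseteq \mathbb F_q^n$ with $|A| = D q^{(1 - 1/(\sigma_q^t - t))n}$ for some $D > 0$, then $A$ contains more than \[\left(1 - \frac{q^t}{D^{\sigma_q^t - t}}\right)\frac{\alpha^{\sigma_q^t} N^{t+1}}{|\mathrm{Aut}_{\mathrm{aff}}(\mathbb F_q^t)|}\] affine $t$-dimensional subspaces, where $N = q^n$ and $|A| = \alpha N$.
   Context: $\mathrm{ex}_{\mathrm{aff}}(n,\mathbb F_q^t)$ is the maximum size of a subset of $\mathbb F_q^n$ containing no affine subspace of dimension $t$. $\mathrm{Aut}_{\mathrm{aff}}(\mathbb F_q^t)$ is the group of bijective affine maps $\mathbb F_q^t \to \mathbb F_q^t$. The constant $C_0 \approx 13.901$ is the absolute constant $C_0 = 1 + 1/(1-\log_3 \gamma)$ with $\gamma = \min_{0<x<1}(1+x+x^2)/x^{2/3} \approx 2.7552$ (the constant of Fox–Pham's theorem); it has the known property that every $A \subseteq \mathbb F_3^n$ with $|A| = \alpha 3^n$ contains at least $\alpha^{C_0} 3^{2n}$ triples of the form $(x, x+d, x+2d)$ with $x,d \in \mathbb F_3^n$. *)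

theory Defs
  imports "HOL-Analysis.Analysis" "HOL-Library.FuncSet"
begin

text \<open>Vectors of F^n are modelled as functions nat => 'a vanishing outside {0..<n},
  where 'a is a finite field with q elements.\<close>

definition vecs :: "nat \<Rightarrow> (nat \<Rightarrow> 'a::zero) set" where
  "vecs n = {x. \<forall>i\<ge>n. x i = 0}"

definition affine_subspaces :: "nat \<Rightarrow> nat \<Rightarrow> (nat \<Rightarrow> 'a::field) set set" where
  "affine_subspaces n t =
    {S. \<exists>x0 \<in> vecs n. \<exists>v :: nat \<Rightarrow> nat \<Rightarrow> 'a.
        (\<forall>i<t. v i \<in> vecs n)
      \<and> (\<forall>c \<in> vecs t. (\<lambda>j. \<Sum>i<t. c i * v i j) = (\<lambda>j. 0) \<longrightarrow> (\<forall>i<t. c i = 0))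
      \<and> S = {(\<lambda>j. x0 j + (\<Sum>i<t. c i * v i j)) | c. c \<in> vecs t}}"

definition ex_aff :: "'a::{field,finite} itself \<Rightarrow> nat \<Rightarrow> nat \<Rightarrow> nat" where
  "ex_aff _ n t = Max {card A | A :: (nat \<Rightarrow> 'a) set.
      A \<subseteq> vecs n \<and> \<not> (\<exists>S \<in> affine_subspaces n t. S \<subseteq> A)}"

definition Aut_aff :: "nat \<Rightarrow> ((nat \<Rightarrow> 'a::field) \<Rightarrow> (nat \<Rightarrow> 'a)) set" where
  "Aut_aff t = {f. f \<in> extensional (vecs t) \<and> bij_betw f (vecs t) (vecs t) \<and>
      (\<exists>(M :: nat \<Rightarrow> nat \<Rightarrow> 'a) b. b \<in> vecs t \<and>
         (\<forall>x \<in> vecs t. f x = (\<lambda>j. if j < t then b j + (\<Sum>i<t. M j i * x i) else 0)))}"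

definition gamma_FP :: real where
  "gamma_FP = Inf ((\<lambda>x::real. (1 + x + x\<^sup>2) / x powr (2/3)) ` {0<..<1})"

definition C0 :: real where
  "C0 = 1 + 1 / (1 - log 3 gamma_FP)"

definition sigma :: "nat \<Rightarrow> real" where
  "sigma q = (if q = 2 then 2 else C0)"

end

theory Submission
  imports Defs
begin

text \<open>For \<open>q = 3\<close> the exponent \<open>C0\<close> comes from the slice rank bound: a set
  without nontrivial lines in \<open>F_3^m\<close> has at most \<open>3 * gamma_FP ^ m\<close> points. Pulling \<open>A\<close> back
  along a random affine map from \<open>F_3^m\<close> and deleting one point from every line of the preimage,
  with \<open>m\<close> just large enough that the preimage has on average at least twice as many points as
  this bound, shows that \<open>A\<close> contains at least \<open>(\<alpha> / 6) powr C0 * N\<^sup>2\<close> lines; taking large cartesian powers of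
  \<open>A\<close> removes the constant 6.

  An affine map from \<open>F_q^(t + 1)\<close> into \<open>A\<close> is a direction \<open>d\<close> together with an affine map from
  \<open>F_q^t\<close> into the set of points whose line in direction \<open>d\<close> lies in \<open>A\<close>. By induction and
  convexity, there are at least \<open>\<alpha> powr (\<sigma> ^ t) * N ^ (t + 1)\<close> affine maps into \<open>A\<close>. At most
  \<open>(q ^ t - 1) * card A ^ t\<close> of them are degenerate, since a linear relation lets \<open>t\<close> points
  determine the map, and every affine subspace is the image of at most \<open>card Aut_aff\<close> injective ones.\<close>

text \<open>The index set is arbitrary, not only an initial segment of the naturals, because
  cartesian powers of a set live over \<open>I \<times> {..<k}\<close>.\<close>

definition supported :: "'i set \<Rightarrow> ('i \<Rightarrow> 'a::zero) set" where
  "supported I = {x. \<forall>i. i \<notin> I \<longrightarrow> x i = 0}"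

lemma vecs_eq_supported: "vecs n = supported {..<n}"
  by (auto simp: vecs_def supported_def)

lemma bij_betw_restrict_supported: "bij_betw (\<lambda>x. restrict x I) (supported I) (I \<rightarrow>\<^sub>E (UNIV :: 'a::zero set))"
  by (rule bij_betwI[where g = "\<lambda>x i. if i \<in> I then x i else 0"])
    (auto simp: supported_def fun_eq_iff PiE_def extensional_def)

lemma card_supported: "finite I \<Longrightarrow> card (supported I :: ('i \<Rightarrow> 'a::{zero,finite}) set) = CARD('a) ^ card I"
  using bij_betw_same_card[OF bij_betw_restrict_supported[where 'a = 'a], of I] by (simp add: card_PiE)

lemma finite_supported [simp]: "finite I \<Longrightarrow> finite (supported I :: ('i \<Rightarrow> 'a::{zero,finite}) set)"
  using bij_betw_finite[OF bij_betw_restrict_supported[where 'a = 'a], of I] by (simp add: finite_PiE)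

lemma zero_in_supported [simp]: "(\<lambda>_. 0) \<in> supported I"
  by (simp add: supported_def)

section \<open>The slice rank bound for cap sets\<close>

text \<open>Gaussian elimination on \<open>card I\<close> linear equations for the unknown values of
  \<open>h\<close>: at most one pivot per equation is put into \<open>C\<close>, the values off
  \<open>C\<close> are free, and those on \<open>C\<close> are then solved for.\<close>

lemma annihilator_off_small_set:
  fixes f :: "'i \<Rightarrow> 'b \<Rightarrow> 'a::field"
  assumes "finite I" "finite A"
  shows "\<exists>C\<subseteq>A. card C \<le> card I \<and>
           (\<forall>u. \<exists>h. (\<forall>x\<in>A - C. h x = u x) \<and> (\<forall>i\<in>I. (\<Sum>x\<in>A. h x * f i x) = 0))"
  using assms
proof (induction I arbitrary: A f rule: finite_induct)
  case empty
  then show ?case by (intro exI[of _ "{}"]) auto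
next
  case (insert k I)
  show ?case
  proof (cases "\<forall>x\<in>A. f k x = 0")
    case True
    from insert.IH[OF insert.prems, of f] obtain C where C: "C \<subseteq> A" "card C \<le> card I"
      "\<forall>u. \<exists>h. (\<forall>x\<in>A - C. h x = u x) \<and> (\<forall>i\<in>I. (\<Sum>x\<in>A. h x * f i x) = 0)" by blast
    then show ?thesis using insert.hyps True
      by (intro exI[of _ C]) (auto simp: sum.neutral)
  next
    case False
    then obtain p where p: "p \<in> A" "f k p \<noteq> 0" by blast
    \<comment> \<open>Subtracting a multiple of the pivot row \<open>f k\<close> makes every
      \<open>g i\<close> vanish at \<open>p\<close>, so the remaining equations live on
      \<open>A - {p}\<close>.\<close>
    define g where "g = (\<lambda>i x. f i x - f i p / f k p * f k x)"
    have fin: "finite (A - {p})" using insert.prems by simp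
    from insert.IH[OF fin, of g] obtain C where C: "C \<subseteq> A - {p}" "card C \<le> card I"
      "\<And>u. \<exists>h. (\<forall>x\<in>A - {p} - C. h x = u x) \<and> (\<forall>i\<in>I. (\<Sum>x\<in>A - {p}. h x * g i x) = 0)"
      by blast
    have "\<exists>h. (\<forall>x\<in>A - insert p C. h x = u x) \<and> (\<forall>i\<in>insert k I. (\<Sum>x\<in>A. h x * f i x) = 0)" for u
    proof -
      from C(3)[of u] obtain h where h: "\<And>x. x \<in> A - {p} - C \<Longrightarrow> h x = u x"
        "\<And>i. i \<in> I \<Longrightarrow> (\<Sum>x\<in>A - {p}. h x * g i x) = 0" by blast
      define s where "s = (\<Sum>x\<in>A - {p}. h x * f k x)"
      \<comment> \<open>The value at the pivot is forced by the equation of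
        \<open>f k\<close>.\<close>
      define h' where "h' = h(p := - s / f k p)"
      have split: "(\<Sum>x\<in>A. h' x * f i x) = - s / f k p * f i p + (\<Sum>x\<in>A - {p}. h x * f i x)" for i
      proof -
        have "(\<Sum>x\<in>A. h' x * f i x) = h' p * f i p + (\<Sum>x\<in>A - {p}. h' x * f i x)"
          using insert.prems p by (simp add: sum.remove)
        also have "(\<Sum>x\<in>A - {p}. h' x * f i x) = (\<Sum>x\<in>A - {p}. h x * f i x)"
          by (intro sum.cong) (auto simp: h'_def)
        finally show ?thesis by (simp add: h'_def)
      qed
      have "(\<Sum>x\<in>A. h' x * f i x) = 0" if "i \<in> insert k I" for i
      proof (cases "i = k")
        case True
        then show ?thesis using p by (simp add: split s_def)
      next
        case False
        with that have "0 = (\<Sum>x\<in>A - {p}. h x * g i x)" using h(2) by simp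
        also have "\<dots> = (\<Sum>x\<in>A - {p}. h x * f i x - f i p / f k p * (h x * f k x))"
          by (intro sum.cong) (auto simp: g_def algebra_simps)
        also have "\<dots> = (\<Sum>x\<in>A - {p}. h x * f i x) - f i p / f k p * s"
          by (simp add: sum_subtractf s_def sum_distrib_left)
        finally show ?thesis by (simp add: split)
      qed
      moreover have "\<forall>x\<in>A - insert p C. h' x = u x" using h(1) by (auto simp: h'_def)
      ultimately show ?thesis by blast
    qed
    moreover have "card (insert p C) \<le> card (insert k I)"
      using C fin insert.hyps by (metis card_insert_disjoint card_insert_le_m1 diff_Suc_1 zero_less_Suc)
    ultimately show ?thesis using C(1) p(1) by (intro exI[of _ "insert p C"]) auto
  qed
qed

section \<open>Arithmetic in the field with three elements\<close>

lemma UNIV_card_3: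
  assumes "CARD('a::{field,finite}) = 3"
  shows "(UNIV :: 'a set) = {0, 1, -1}" and "(1 :: 'a) + 1 + 1 = 0" and "(1 :: 'a) \<noteq> -1"
proof -
  have "\<not> (UNIV :: 'a set) \<subseteq> {0, 1}"
    using assms card_mono[of "{0, 1 :: 'a}" UNIV] by (auto simp: card_insert_if)
  then obtain u :: 'a where u: "u \<noteq> 0" "u \<noteq> 1" by blast
  have U: "(UNIV :: 'a set) = {0, 1, u}"
    by (rule sym, rule card_subset_eq) (use u assms in \<open>auto simp: card_insert_if\<close>)
  have two: "(1::'a) + 1 \<noteq> 0"
  proof
    assume *: "(1::'a) + 1 = 0"
    \<comment> \<open>Here \<open>u + 1\<close> can be neither \<open>1\<close> nor
      \<open>u\<close>, so it is \<open>0 = 1 + 1\<close>, which forces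
      \<open>u = 1\<close>.\<close>
    have "u + 1 \<in> {0, 1, u}" using U by blast
    with u have "u + 1 = 0" by auto
    with * u show False by (metis add_right_cancel)
  qed
  have "(1::'a) + 1 \<in> {0, 1, u}" using U by blast
  moreover have "(1::'a) + 1 \<noteq> 1" by (metis add_cancel_left_right zero_neq_one)
  ultimately have u2: "1 + 1 = u" using two by blast
  have neg: "-(1::'a) \<in> {0, 1, u}" using U by blast
  show ne: "(1 :: 'a) \<noteq> -1" using two by (metis add.right_inverse)
  with neg have nu: "-1 = u" by (metis insertE neg_equal_0_iff_equal singletonD zero_neq_one)
  with U show "(UNIV :: 'a set) = {0, 1, -1}" by simp
  show "(1 :: 'a) + 1 + 1 = 0" using nu u2 by (metis add.left_inverse)
qed

lemma triple_add_0:
  assumes "CARD('a::{field,finite}) = 3"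
  shows "x + x + x = (0 :: 'a)"
proof -
  have "x + x + x = (1 + 1 + 1) * x" by (simp add: algebra_simps)
  then show ?thesis using UNIV_card_3(2)[OF assms] by simp
qed

lemma one_minus_square:
  assumes "CARD('a::{field,finite}) = 3"
  shows "1 - (s :: 'a)\<^sup>2 = (if s = 0 then 1 else 0)"
proof -
  have "s \<in> {0, 1, -1}" using UNIV_card_3(1)[OF assms] by blast
  then show ?thesis by (auto simp: power2_eq_square)
qed

section \<open>Polynomial expansion of the indicator of zero-sum triples\<close>

definition monomial :: "'i set \<Rightarrow> ('i \<Rightarrow> nat) \<Rightarrow> ('i \<Rightarrow> 'a::comm_monoid_mult) \<Rightarrow> 'a" where
  "monomial I a x = (\<Prod>i\<in>I. x i ^ a i)"

text \<open>The threshold is one third of \<open>2 * card I\<close>, the total degree of the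
  polynomial expanded below, so that three variables cannot all exceed it.\<close>

definition low_exponents :: "'i set \<Rightarrow> ('i \<Rightarrow> nat) set" where
  "low_exponents I = {a \<in> I \<rightarrow>\<^sub>E {..2}. 3 * sum a I \<le> 2 * card I}"

lemma finite_low_exponents: "finite I \<Longrightarrow> finite (low_exponents I)"
  by (simp add: low_exponents_def finite_PiE)

text \<open>These are the exponent triples of the monomials in \<open>1 - (x + y + z)^2\<close>; the
  entries of each triple sum to at most 2.\<close>

definition factor_exponents :: "(nat \<times> nat \<times> nat) set" where
  "factor_exponents = {(0,0,0), (2,0,0), (0,2,0), (0,0,2), (1,1,0), (1,0,1), (0,1,1)}"

definition factor_coeff :: "nat \<times> nat \<times> nat \<Rightarrow> 'a::comm_ring_1" where
  "factor_coeff e = (if e = (0,0,0) then 1 else if e \<in> {(2,0,0), (0,2,0), (0,0,2)} then -1 else -2)"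

lemma factor_expand:
  fixes x y z :: "'a::comm_ring_1"
  shows "1 - (x + y + z)\<^sup>2 = (\<Sum>e\<in>factor_exponents. factor_coeff e * (x ^ fst e * y ^ fst (snd e) * z ^ snd (snd e)))"
  by (simp add: factor_exponents_def factor_coeff_def power2_eq_square algebra_simps)

text \<open>Nonzero squares are 1 in this field, so the indicator is a product over the coordinates
  of \<open>1 - (x i + y i + z i)^2\<close>. Multiplying out means choosing one monomial
  \<open>g i\<close> for each coordinate.\<close>

lemma zero_sum_indicator_expand:
  fixes x y z :: "'i \<Rightarrow> 'a::{field,finite}"
  assumes q: "CARD('a) = 3" and I: "finite I"
  shows "(if \<forall>i\<in>I. x i + y i + z i = 0 then 1 else 0) =
    (\<Sum>g\<in>I \<rightarrow>\<^sub>E factor_exponents. (\<Prod>i\<in>I. factor_coeff (g i)) * (monomial I (restrict (fst \<circ> g) I) x *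
       monomial I (restrict (fst \<circ> snd \<circ> g) I) y * monomial I (restrict (snd \<circ> snd \<circ> g) I) z))"
proof -
  have "(if \<forall>i\<in>I. x i + y i + z i = 0 then 1 else 0) = (\<Prod>i\<in>I. 1 - (x i + y i + z i)\<^sup>2)"
  proof -
    have "(\<Prod>i\<in>I. 1 - (x i + y i + z i)\<^sup>2) = (\<Prod>i\<in>I. if x i + y i + z i = 0 then 1 else 0)"
      by (simp add: one_minus_square[OF q])
    also have "\<dots> = (if \<forall>i\<in>I. x i + y i + z i = 0 then 1 else 0)"
      using I by (auto simp: prod_zero_iff)
    finally show ?thesis ..
  qed
  also have "\<dots> = (\<Sum>g\<in>I \<rightarrow>\<^sub>E factor_exponents. \<Prod>i\<in>I. factor_coeff (g i) *
      (x i ^ fst (g i) * y i ^ fst (snd (g i)) * z i ^ snd (snd (g i))))"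
    unfolding factor_expand by (rule prod_sum_PiE) (auto simp: I factor_exponents_def)
  also have "\<dots> = (\<Sum>g\<in>I \<rightarrow>\<^sub>E factor_exponents. (\<Prod>i\<in>I. factor_coeff (g i)) * (monomial I (restrict (fst \<circ> g) I) x *
       monomial I (restrict (fst \<circ> snd \<circ> g) I) y * monomial I (restrict (snd \<circ> snd \<circ> g) I) z))"
    by (intro sum.cong refl) (simp add: prod.distrib monomial_def)
  finally show ?thesis .
qed

text \<open>Pigeonhole: the three degrees add up to at most \<open>2 * card I\<close>, so one of
  them is at most a third of that.\<close>

lemma low_exponents_cases:
  assumes g: "g \<in> I \<rightarrow>\<^sub>E factor_exponents" and I: "finite I"
  shows "restrict (fst \<circ> g) I \<in> low_exponents I \<or> restrict (fst \<circ> snd \<circ> g) I \<in> low_exponents I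
    \<or> restrict (snd \<circ> snd \<circ> g) I \<in> low_exponents I"
proof -
  have b: "fst (g i) + fst (snd (g i)) + snd (snd (g i)) \<le> 2" if "i \<in> I" for i
  proof -
    have "g i \<in> factor_exponents" using g that by auto
    then show ?thesis by (auto simp: factor_exponents_def)
  qed
  have "(\<Sum>i\<in>I. fst (g i)) + (\<Sum>i\<in>I. fst (snd (g i))) + (\<Sum>i\<in>I. snd (snd (g i))) \<le> 2 * card I"
    using sum_mono[of I "\<lambda>i. fst (g i) + fst (snd (g i)) + snd (snd (g i))" "\<lambda>_. 2"] b
    by (simp add: sum.distrib mult.commute)
  moreover have "fst (g i) \<le> 2" "fst (snd (g i)) \<le> 2" "snd (snd (g i)) \<le> 2" if "i \<in> I" for i
    using b[OF that] by auto
  ultimately show ?thesis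
    by (auto simp: low_exponents_def PiE_def Pi_def)
qed

text \<open>Slice rank: a weight \<open>h\<close> orthogonal to all low monomials kills the terms of low
  degree in the first variable and leaves a matrix of rank at most \<open>2 * card (low_exponents I)\<close>,
  while for a cap set \<open>A\<close> it is diagonal with few zeros.\<close>

lemma cap_set_bound:
  fixes A :: "('i \<Rightarrow> 'a::{field,finite}) set"
  assumes q: "CARD('a) = 3" and I: "finite I" and A: "A \<subseteq> supported I"
    and cap: "\<And>x d. x \<in> A \<Longrightarrow> (\<lambda>j. x j + d j) \<in> A \<Longrightarrow> (\<lambda>j. x j - d j) \<in> A \<Longrightarrow> d = (\<lambda>_. 0)"
  shows "card A \<le> 3 * card (low_exponents I)"
proof -
  have finA: "finite A" using A I finite_subset finite_supported by blast
  let ?G = "I \<rightarrow>\<^sub>E factor_exponents"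
  define a where "a = (\<lambda>g. restrict (fst \<circ> (g :: 'i \<Rightarrow> nat \<times> nat \<times> nat)) I)"
  define b where "b = (\<lambda>g. restrict (fst \<circ> snd \<circ> (g :: 'i \<Rightarrow> nat \<times> nat \<times> nat)) I)"
  define c where "c = (\<lambda>g. restrict (snd \<circ> snd \<circ> (g :: 'i \<Rightarrow> nat \<times> nat \<times> nat)) I)"
  define k where "k = (\<lambda>g. (\<Prod>i\<in>I. factor_coeff (g i)) :: 'a)"
  have finG: "finite ?G" using I by (simp add: finite_PiE factor_exponents_def)
  have diag: "(\<forall>i\<in>I. x i + y i + z i = 0) \<longleftrightarrow> x = y \<and> y = z"
    if "x \<in> A" "y \<in> A" "z \<in> A" for x y z
  proof
    assume *: "\<forall>i\<in>I. x i + y i + z i = 0"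
    have "x \<in> supported I" "y \<in> supported I" "z \<in> supported I" using that A by auto
    then have **: "x i + y i + z i = 0" for i
      using * by (cases "i \<in> I") (auto simp: supported_def)
    \<comment> \<open>In characteristic 3 a zero-sum triple is a progression: with
      \<open>d = y - x\<close> the other two points are \<open>x + d\<close> and
      \<open>x - d\<close>, so \<open>cap\<close> applies.\<close>
    have z: "z = (\<lambda>j. x j - (y j - x j))"
    proof
      fix j
      have "z j = - x j - y j" using **[of j] by (simp add: algebra_simps add_eq_0_iff)
      also have "\<dots> = x j - (y j - x j) - (x j + x j + x j)" by (simp add: algebra_simps)
      finally show "z j = x j - (y j - x j)" using triple_add_0[OF q] by simp
    qed
    have "(\<lambda>j. y j - x j) = (\<lambda>_. 0)" using that z by (intro cap[of x]) auto
    then have "y = x" by (auto simp: fun_eq_iff)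
    with z show "x = y \<and> y = z" by simp
  next
    assume "x = y \<and> y = z"
    then show "\<forall>i\<in>I. x i + y i + z i = 0" using triple_add_0[OF q] by simp
  qed
  have expand: "(if x = y \<and> y = z then 1 else 0) =
      (\<Sum>g\<in>?G. k g * (monomial I (a g) x * monomial I (b g) y * monomial I (c g) z))"
    if "x \<in> A" "y \<in> A" "z \<in> A" for x y z :: "'i \<Rightarrow> 'a"
    using zero_sum_indicator_expand[OF q I, of x y z] diag[OF that]
    unfolding a_def b_def c_def k_def by simp
  from annihilator_off_small_set[OF finite_low_exponents[OF I] finA, of "monomial I"] obtain C where
    C: "C \<subseteq> A" "card C \<le> card (low_exponents I)"
    and ex: "\<And>u. \<exists>h. (\<forall>x\<in>A - C. h x = u x) \<and> (\<forall>e\<in>low_exponents I. (\<Sum>x\<in>A. h x * monomial I e x) = 0)"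
    by blast
  from ex[of "\<lambda>_. 1"] obtain h where h1: "\<And>x. x \<in> A - C \<Longrightarrow> h x = 1"
    and h0: "\<And>e. e \<in> low_exponents I \<Longrightarrow> (\<Sum>x\<in>A. h x * monomial I e x) = 0"
    by blast
  define B where "B = A - C"
  have finB: "finite B" using finA by (simp add: B_def)
  define G2 where "G2 = {g \<in> ?G. a g \<notin> low_exponents I \<and> b g \<in> low_exponents I}"
  define G3 where "G3 = {g \<in> ?G. a g \<notin> low_exponents I \<and> b g \<notin> low_exponents I}"
  define w where "w = (\<lambda>g. k g * (\<Sum>x\<in>A. h x * monomial I (a g) x))"
  \<comment> \<open>Summing the expansion against \<open>h\<close> over the first variable leaves
    the identity matrix on \<open>B\<close>, because \<open>h\<close> is 1 there.\<close>
  have rank: "(if y = z then 1 else 0) =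
      (\<Sum>g\<in>G2. w g * monomial I (b g) y * monomial I (c g) z) + (\<Sum>g\<in>G3. w g * monomial I (b g) y * monomial I (c g) z)"
    if "y \<in> B" "z \<in> B" for y z
  proof -
    have yz: "y \<in> A" "z \<in> A" using that by (auto simp: B_def)
    have "(if y = z then 1 else 0) = (\<Sum>x\<in>A. if x = y then (if y = z then h x else 0) else 0)"
      using finA yz h1[of z] that by (simp add: B_def)
    also have "\<dots> = (\<Sum>x\<in>A. h x * (if x = y \<and> y = z then 1 else 0))"
      by (intro sum.cong) auto
    also have "\<dots> = (\<Sum>x\<in>A. \<Sum>g\<in>?G. h x * (k g * (monomial I (a g) x * monomial I (b g) y * monomial I (c g) z)))"
      using expand yz by (simp add: sum_distrib_left)
    also have "\<dots> = (\<Sum>g\<in>?G. \<Sum>x\<in>A. h x * (k g * (monomial I (a g) x * monomial I (b g) y * monomial I (c g) z)))"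
      by (rule sum.swap)
    also have "\<dots> = (\<Sum>g\<in>?G. w g * monomial I (b g) y * monomial I (c g) z)"
      by (intro sum.cong) (simp_all add: w_def sum_distrib_left sum_distrib_right mult_ac)
    also have "\<dots> = (\<Sum>g\<in>G2 \<union> G3. w g * monomial I (b g) y * monomial I (c g) z)"
      by (rule sum.mono_neutral_right) (use finG h0 in \<open>auto simp: G2_def G3_def w_def\<close>)
    also have "\<dots> = (\<Sum>g\<in>G2. w g * monomial I (b g) y * monomial I (c g) z) + (\<Sum>g\<in>G3. w g * monomial I (b g) y * monomial I (c g) z)"
      by (rule sum.union_disjoint) (use finG in \<open>auto simp: G2_def G3_def\<close>)
    finally show ?thesis .
  qed
  \<comment> \<open>Terms of \<open>G3\<close> have low degree in \<open>z\<close>. Grouping them by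
    that exponent \<open>e\<close> writes their sum with only \<open>card (low_exponents I)\<close>
    functions of \<open>y\<close>.\<close>
  define r where "r = (\<lambda>e y. \<Sum>g\<in>{g \<in> G3. c g = e}. w g * monomial I (b g) y)"
  define p where "p = (\<lambda>s. case s of Inl e \<Rightarrow> monomial I e | Inr e \<Rightarrow> r e)"
  have finL: "finite (low_exponents I <+> low_exponents I)" using finite_low_exponents[OF I] by simp
  from annihilator_off_small_set[OF finL finB, of p] obtain C' where
    C': "C' \<subseteq> B" "card C' \<le> card (low_exponents I <+> low_exponents I)"
    and ex': "\<And>u. \<exists>h. (\<forall>x\<in>B - C'. h x = u x) \<and> (\<forall>s\<in>low_exponents I <+> low_exponents I. (\<Sum>x\<in>B. h x * p s x) = 0)"
    by blast
  from ex'[of "\<lambda>_. 1"] obtain h' where h1': "\<And>x. x \<in> B - C' \<Longrightarrow> h' x = 1"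
    and h0': "\<And>s. s \<in> low_exponents I <+> low_exponents I \<Longrightarrow> (\<Sum>x\<in>B. h' x * p s x) = 0"
    by blast
  \<comment> \<open>The weight \<open>h'\<close> is orthogonal to every function of \<open>y\<close>
    on the right of \<open>rank\<close>, while against the identity matrix it returns its own value.
    As \<open>h'\<close> is 1 off \<open>C'\<close>, this leaves \<open>B = C'\<close>.\<close>
  have "h' z = 0" if z: "z \<in> B" for z
  proof -
    have e2: "(\<Sum>y\<in>B. h' y * monomial I e y) = 0" if "e \<in> low_exponents I" for e
      using h0'[of "Inl e"] that by (auto simp: p_def)
    have e3: "(\<Sum>y\<in>B. h' y * r e y) = 0" if "e \<in> low_exponents I" for e
      using h0'[of "Inr e"] that by (auto simp: p_def)
    have G3c: "c g \<in> low_exponents I" if "g \<in> G3" for g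
      using that low_exponents_cases[OF _ I, of g] by (auto simp: G3_def a_def b_def c_def)
    have finG3: "finite G3" using finG by (simp add: G3_def)
    have grp: "(\<Sum>g\<in>G3. w g * monomial I (b g) y * monomial I (c g) z) = (\<Sum>e\<in>low_exponents I. r e y * monomial I e z)" for y
    proof -
      have "(\<Sum>g\<in>G3. w g * monomial I (b g) y * monomial I (c g) z) =
          (\<Sum>e\<in>low_exponents I. \<Sum>g\<in>{g \<in> G3. c g = e}. w g * monomial I (b g) y * monomial I (c g) z)"
        by (rule sum.group[symmetric]) (use finG3 finite_low_exponents[OF I] G3c in auto)
      then show ?thesis by (simp add: r_def sum_distrib_right)
    qed
    have "h' z = (\<Sum>y\<in>B. if y = z then h' y else 0)" using finB z by simp
    also have "\<dots> = (\<Sum>y\<in>B. h' y * (if y = z then 1 else 0))" by (intro sum.cong) auto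
    also have "\<dots> = (\<Sum>y\<in>B. h' y * ((\<Sum>g\<in>G2. w g * monomial I (b g) y * monomial I (c g) z)
        + (\<Sum>e\<in>low_exponents I. r e y * monomial I e z)))"
      using rank z by (simp add: grp)
    also have "\<dots> = (\<Sum>g\<in>G2. w g * monomial I (c g) z * (\<Sum>y\<in>B. h' y * monomial I (b g) y))
        + (\<Sum>e\<in>low_exponents I. monomial I e z * (\<Sum>y\<in>B. h' y * r e y))"
      by (simp add: distrib_left sum.distrib sum_distrib_left mult_ac
          sum.swap[of _ B G2] sum.swap[of _ B "low_exponents I"])
    also have "\<dots> = 0" using e2 e3 by (simp add: G2_def)
    finally show ?thesis .
  qed
  with h1' have "B - C' = {}" by force
  then have "card B \<le> 2 * card (low_exponents I)"
    using C' finite_low_exponents[OF I] by (simp add: card_Plus Diff_eq_empty_iff subset_antisym)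
  moreover have "card A = card B + card C"
    using C(1) finA unfolding B_def by (metis Diff_partition card_Un_disjoint Diff_disjoint finite_subset finite_Diff add.commute)
  ultimately show ?thesis using C(2) by simp
qed

section \<open>Counting exponents of low degree\<close>

text \<open>Exponential weighting: since \<open>x < 1\<close>, each low exponent has weight
  \<open>x ^ sum a I\<close> at least \<open>x powr (2/3 * card I)\<close>, while all exponents
  together have weight \<open>(1 + x + x^2) ^ card I\<close>.\<close>

lemma card_low_exponents_le:
  assumes I: "finite I" and x: "0 < x" "x < 1"
  shows "real (card (low_exponents I)) \<le> ((1 + x + x\<^sup>2) / x powr (2/3)) ^ card I"
proof -
  let ?m = "card I"
  have pw: "x powr (2/3 * real ?m) \<le> x ^ sum a I" if "a \<in> low_exponents I" for a
  proof -
    have "real (3 * sum a I) \<le> real (2 * ?m)" using that by (simp only: low_exponents_def of_nat_le_iff) simp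
    then have "real (sum a I) \<le> 2/3 * real ?m" by simp
    then have "x powr (2/3 * real ?m) \<le> x powr real (sum a I)"
      using x by (intro powr_mono') auto
    then show ?thesis using x by (simp only: powr_realpow)
  qed
  have "real (card (low_exponents I)) * x powr (2/3 * real ?m) \<le> (\<Sum>a\<in>low_exponents I. x ^ sum a I)"
    using sum_mono[OF pw] by simp
  also have "\<dots> \<le> (\<Sum>a\<in>I \<rightarrow>\<^sub>E {..2}. x ^ sum a I)"
    by (rule sum_mono2) (use I x in \<open>auto simp: low_exponents_def finite_PiE\<close>)
  also have "\<dots> = (\<Prod>i\<in>I. \<Sum>j\<in>{..2}. x ^ j)"
    by (subst prod_sum_PiE) (simp_all add: I power_sum)
  also have "\<dots> = (1 + x + x\<^sup>2) ^ ?m"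
    by (simp add: numeral_2_eq_2)
  finally have "real (card (low_exponents I)) * x powr (2/3 * real ?m) \<le> (1 + x + x\<^sup>2) ^ ?m" .
  moreover have "x powr (2/3 * real ?m) = (x powr (2/3)) ^ ?m"
    using x by (simp add: powr_powr flip: powr_realpow)
  ultimately show ?thesis using x by (simp add: power_divide field_simps)
qed

lemma gamma_FP_bounds: "1 \<le> gamma_FP" "gamma_FP < 3"
proof -
  let ?f = "\<lambda>x::real. (1 + x + x\<^sup>2) / x powr (2/3)"
  have ge: "1 \<le> ?f x" if "x \<in> {0<..<1}" for x
  proof -
    have "x powr (2/3) \<le> 1" using that by (intro powr_le1) auto
    then show ?thesis using that by (simp add: field_simps) (smt (verit) zero_le_power2)
  qed
  show "1 \<le> gamma_FP" unfolding gamma_FP_def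
    by (rule cINF_greatest) (use ge in auto)
  have "bdd_below (?f ` {0<..<1})" using ge by (intro bdd_belowI2[where m = 1]) auto
  then have "gamma_FP \<le> ?f (1/2)" unfolding gamma_FP_def by (intro cINF_lower) auto
  also have "\<dots> < 3"
  proof -
    define y where "y = (1/2::real) powr (2/3)"
    have y0: "y > 0" by (simp add: y_def)
    have "y ^ 3 = (1/2) powr (2/3 * 3)" unfolding y_def
      by (subst powr_realpow[symmetric]) (simp_all add: powr_powr)
    then have "y ^ 3 = 1/4" by (simp add: power2_eq_square)
    \<comment> \<open>At \<open>1/2\<close> the numerator is \<open>7/4\<close>, so the quotient is
      below 3 exactly when \<open>y > 7/12\<close>.\<close>
    then have "\<not> y \<le> 7/12" using power_mono[of y "7/12" 3] y0 by (auto simp: power3_eq_cube)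
    then show ?thesis using y0 unfolding y_def[symmetric]
      by (simp add: field_simps power2_eq_square)
  qed
  finally show "gamma_FP < 3" .
qed

text \<open>Taking roots of degree \<open>card I\<close> turns the previous bounds into a single
  lower bound of the set whose infimum is \<open>gamma_FP\<close>. The empty index set is separate
  because the degree must be positive.\<close>

lemma card_low_exponents_le_gamma:
  assumes I: "finite I"
  shows "real (card (low_exponents I)) \<le> gamma_FP ^ card I"
proof (cases "card I = 0")
  case True
  then have "I = {}" using I by simp
  then show ?thesis by (simp add: low_exponents_def)
next
  case False
  let ?m = "card I"
  have "root ?m (real (card (low_exponents I))) \<le> gamma_FP"
    unfolding gamma_FP_def
  proof (rule cINF_greatest)
    fix x :: real assume "x \<in> {0<..<1}"
    then have x: "0 < x" "x < 1" by auto
    have "root ?m (real (card (low_exponents I))) \<le> root ?m (((1 + x + x\<^sup>2) / x powr (2/3)) ^ ?m)"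
      using False card_low_exponents_le[OF I x] by simp
    also have "\<dots> = (1 + x + x\<^sup>2) / x powr (2/3)"
      using False x by (intro real_root_power_cancel) auto
    finally show "root ?m (real (card (low_exponents I))) \<le> (1 + x + x\<^sup>2) / x powr (2/3)" .
  qed auto
  then have "root ?m (real (card (low_exponents I))) ^ ?m \<le> gamma_FP ^ ?m"
    by (intro power_mono) (use False in auto)
  then show ?thesis using False by simp
qed

section \<open>Supersaturation of lines over the field with three elements\<close>

definition aff_map :: "nat \<Rightarrow> ('i \<Rightarrow> 'a::semiring_0) \<Rightarrow> (nat \<Rightarrow> 'i \<Rightarrow> 'a) \<Rightarrow> (nat \<Rightarrow> 'a) \<Rightarrow> 'i \<Rightarrow> 'a" where
  "aff_map t x0 v c = (\<lambda>j. x0 j + (\<Sum>i<t. c i * v i j))"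

text \<open>Quantifying over all scalars treats both fields at once: the points required are
  \<open>x\<close>, \<open>x + d\<close> over two elements and \<open>x\<close>,
  \<open>x + d\<close>, \<open>x - d\<close> over three.\<close>

definition line_starts :: "('i \<Rightarrow> 'a::semiring_0) set \<Rightarrow> ('i \<Rightarrow> 'a) \<Rightarrow> ('i \<Rightarrow> 'a) set" where
  "line_starts A d = {x. \<forall>c. (\<lambda>j. x j + c * d j) \<in> A}"

text \<open>The direction \<open>d = 0\<close> is included and contributes \<open>card A\<close> degenerate lines.\<close>

definition line_count :: "'i set \<Rightarrow> ('i \<Rightarrow> 'a::semiring_0) set \<Rightarrow> nat" where
  "line_count I A = (\<Sum>d\<in>supported I. card (line_starts A d))"

lemma line_starts_subset: "line_starts A d \<subseteq> A"
proof
  fix x assume "x \<in> line_starts A d"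
  then have "(\<lambda>j. x j + 0 * d j) \<in> A" unfolding line_starts_def by blast
  then show "x \<in> A" by simp
qed

lemma sum_card_swap:
  assumes "finite X" "finite Y"
  shows "(\<Sum>x\<in>X. card {y \<in> Y. P x y}) = (\<Sum>y\<in>Y. card {x \<in> X. P x y})"
proof -
  have "(\<Sum>x\<in>X. card {y \<in> Y. P x y}) = (\<Sum>x\<in>X. \<Sum>y\<in>Y. if P x y then 1 else 0)"
    using assms by (simp add: sum.If_cases Int_def)
  also have "\<dots> = (\<Sum>y\<in>Y. \<Sum>x\<in>X. if P x y then 1 else 0)" by (rule sum.swap)
  also have "\<dots> = (\<Sum>y\<in>Y. card {x \<in> X. P x y})"
    using assms by (simp add: sum.If_cases Int_def)
  finally show ?thesis .
qed

text \<open>For fixed \<open>c\<close> and \<open>v\<close>, each target in \<open>A\<close> is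
  reached from its own base point, obtained by subtracting the linear part.\<close>

lemma card_aff_hits_ge:
  fixes A :: "('i \<Rightarrow> 'a::{field,finite}) set"
  assumes I: "finite I" and A: "A \<subseteq> supported I"
  shows "card A * card (supported I :: ('i \<Rightarrow> 'a) set) ^ m
    \<le> card {p \<in> supported I \<times> ({..<m} \<rightarrow>\<^sub>E supported I). aff_map m (fst p) (snd p) c \<in> A}"
proof -
  let ?f = "\<lambda>(y, v). ((\<lambda>j. y j - (\<Sum>i<m. c i * v i j)) :: 'i \<Rightarrow> 'a, v)"
  let ?X = "A \<times> ({..<m} \<rightarrow>\<^sub>E (supported I :: ('i \<Rightarrow> 'a) set))"
  have "card ?X \<le> card {p \<in> supported I \<times> ({..<m} \<rightarrow>\<^sub>E supported I). aff_map m (fst p) (snd p) c \<in> A}"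
  proof (rule card_inj_on_le[of ?f])
    show "inj_on ?f ?X" by (auto simp: inj_on_def fun_eq_iff)
    show "?f ` ?X \<subseteq> {p \<in> supported I \<times> ({..<m} \<rightarrow>\<^sub>E supported I). aff_map m (fst p) (snd p) c \<in> A}"
    proof (clarsimp)
      fix y :: "'i \<Rightarrow> 'a" and v :: "nat \<Rightarrow> 'i \<Rightarrow> 'a"
      assume y: "y \<in> A" and v: "v \<in> {..<m} \<rightarrow>\<^sub>E supported I"
      have "v i \<in> supported I" if "i < m" for i using v that by auto
      moreover have "y \<in> supported I" using y A by blast
      ultimately have "(\<lambda>j. y j - (\<Sum>i<m. c i * v i j)) \<in> supported I"
        by (simp add: supported_def)
      then show "(\<lambda>j. y j - (\<Sum>i<m. c i * v i j)) \<in> supported I \<and>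
          aff_map m (\<lambda>j. y j - (\<Sum>i<m. c i * v i j)) v c \<in> A"
        using y by (simp add: aff_map_def)
    qed
    show "finite {p \<in> supported I \<times> ({..<m} \<rightarrow>\<^sub>E supported I). aff_map m (fst p) (snd p) c \<in> A}"
      using I by (simp add: finite_PiE)
  qed
  then show ?thesis by (simp add: card_cartesian_product card_PiE)
qed

text \<open>A combination with \<open>e i0\<close> nonzero can be solved for \<open>v i0\<close>.
  This yields injectivity in both counts where one direction is dropped.\<close>

lemma combination_determines:
  fixes v v' :: "nat \<Rightarrow> 'i \<Rightarrow> 'a::field"
  assumes v: "v \<in> {..<m} \<rightarrow>\<^sub>E X" "v' \<in> {..<m} \<rightarrow>\<^sub>E X" and i0: "i0 < m" "e i0 \<noteq> 0"
    and rest: "\<And>i. i < m \<Longrightarrow> i \<noteq> i0 \<Longrightarrow> v i = v' i"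
    and eq: "\<And>j. (\<Sum>i<m. e i * v i j) = (\<Sum>i<m. e i * v' i j)"
  shows "v = v'"
proof (rule PiE_ext[OF v])
  have "v i0 j = v' i0 j" for j
  proof -
    have "(\<Sum>i\<in>{..<m} - {i0}. e i * v i j) = (\<Sum>i\<in>{..<m} - {i0}. e i * v' i j)"
      using rest by (intro sum.cong) auto
    with eq[of j] show ?thesis using i0 by (simp add: sum.remove[of "{..<m}" i0])
  qed
  then show "v i = v' i" if "i \<in> {..<m}" for i using rest that by (cases "i = i0") auto
qed

text \<open>The line through \<open>c\<close> in direction \<open>e\<close> is sent to a line of
  \<open>A\<close>. Its start and direction, together with all \<open>v i\<close> except
  \<open>v i0\<close>, determine the map, so each line arises at most \<open>N ^ (m - 1)\<close>
  times, where \<open>N\<close> is the size of the space. The extra factor on the left avoids the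
  subtraction in the exponent.\<close>

lemma card_aff_lines_le:
  fixes A :: "('i \<Rightarrow> 'a::{field,finite}) set"
  assumes I: "finite I" and A: "A \<subseteq> supported I" and e: "e \<in> supported {..<m}" "e \<noteq> (\<lambda>_. 0)"
  shows "card (supported I :: ('i \<Rightarrow> 'a) set) *
      card {p \<in> supported I \<times> ({..<m} \<rightarrow>\<^sub>E supported I). \<forall>a. aff_map m (fst p) (snd p) (\<lambda>i. c i + a * e i) \<in> A}
    \<le> line_count I A * card (supported I :: ('i \<Rightarrow> 'a) set) ^ m"
proof -
  let ?N = "card (supported I :: ('i \<Rightarrow> 'a) set)"
  let ?P = "{p \<in> supported I \<times> ({..<m} \<rightarrow>\<^sub>E supported I). \<forall>a. aff_map m (fst p) (snd p) (\<lambda>i. c i + a * e i) \<in> A}"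
  from e obtain i0 where i0: "i0 < m" "e i0 \<noteq> 0" by (auto simp: supported_def fun_eq_iff)
  have finA: "finite A" using A I finite_subset finite_supported by blast
  let ?f = "\<lambda>p. (((\<lambda>j. \<Sum>i<m. e i * snd p i j), aff_map m (fst p) (snd p) c), restrict (snd p) ({..<m} - {i0}))"
  let ?Y = "(SIGMA d:supported I. line_starts A d) \<times> ({..<m} - {i0} \<rightarrow>\<^sub>E (supported I :: ('i \<Rightarrow> 'a) set))"
  have "card ?P \<le> card ?Y"
  proof (rule card_inj_on_le[of ?f])
    show "inj_on ?f ?P"
    proof (rule inj_onI)
      fix p p' assume p: "p \<in> ?P" and p': "p' \<in> ?P" and eq: "?f p = ?f p'"
      obtain x v where pp: "p = (x, v)" by force
      obtain x' v' where pp': "p' = (x', v')" by force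
      have v: "v \<in> {..<m} \<rightarrow>\<^sub>E supported I" "v' \<in> {..<m} \<rightarrow>\<^sub>E supported I" using p p' pp pp' by auto
      have vv: "v = v'"
      proof (rule combination_determines[where e = e, OF v i0])
        show "v i = v' i" if "i < m" "i \<noteq> i0" for i
          using eq that unfolding pp pp' by (auto simp: fun_eq_iff restrict_def split: if_splits)
        show "(\<Sum>i<m. e i * v i j) = (\<Sum>i<m. e i * v' i j)" for j
          using eq unfolding pp pp' by (auto simp: fun_eq_iff)
      qed
      have "aff_map m x v c = aff_map m x' v' c" using eq unfolding pp pp' by simp
      then have "x = x'" unfolding vv by (auto simp: aff_map_def fun_eq_iff)
      with vv show "p = p'" by (simp add: pp pp')
    qed
    show "?f ` ?P \<subseteq> ?Y"
    proof (rule image_subsetI)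
      fix p assume p: "p \<in> ?P"
      then have v: "\<And>i. i < m \<Longrightarrow> snd p i \<in> supported I" by auto
      have "(\<lambda>j. \<Sum>i<m. e i * snd p i j) \<in> supported I" using v by (simp add: supported_def)
      moreover have "(\<lambda>j. aff_map m (fst p) (snd p) c j + a * (\<Sum>i<m. e i * snd p i j)) \<in> A" for a
      proof -
        have "(\<lambda>j. aff_map m (fst p) (snd p) c j + a * (\<Sum>i<m. e i * snd p i j)) =
            aff_map m (fst p) (snd p) (\<lambda>i. c i + a * e i)"
          by (simp add: aff_map_def fun_eq_iff sum_distrib_left sum.distrib algebra_simps)
        then show ?thesis using p by simp
      qed
      ultimately show "?f p \<in> ?Y" using p v by (auto simp: line_starts_def)
    qed
    show "finite ?Y"
      using I finA by (auto intro!: finite_SigmaI finite_PiE finite_subset[OF line_starts_subset])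
  qed
  also have "card ?Y = line_count I A * ?N ^ (m - 1)"
    using I finA i0 finite_subset[OF line_starts_subset finA]
    by (simp add: card_cartesian_product card_PiE line_count_def card_Diff_singleton)
  finally have "?N * card ?P \<le> ?N * (line_count I A * ?N ^ (m - 1))" by (rule mult_le_mono2)
  also have "\<dots> = line_count I A * ?N ^ m" using i0(1) by (cases m) auto
  finally show ?thesis .
qed

text \<open>Deleting the starting points of all nontrivial lines leaves a cap set.\<close>

lemma card_le_low_plus_lines:
  fixes B :: "('i \<Rightarrow> 'a::{field,finite}) set"
  assumes q: "CARD('a) = 3" and I: "finite I" and B: "B \<subseteq> supported I"
  shows "card B \<le> 3 * card (low_exponents I) + (\<Sum>e\<in>supported I - {\<lambda>_. 0}. card (line_starts B e))"
proof -
  let ?U = "\<Union>e\<in>supported I - {\<lambda>_. 0}. line_starts B e"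
  have finB: "finite B" using B I finite_subset finite_supported by blast
  have "card (B - ?U) \<le> 3 * card (low_exponents I)"
  proof (rule cap_set_bound[OF q I])
    show "B - ?U \<subseteq> supported I" using B by blast
    fix x d assume x: "x \<in> B - ?U" "(\<lambda>j. x j + d j) \<in> B - ?U" "(\<lambda>j. x j - d j) \<in> B - ?U"
    have "(\<lambda>j. x j + c * d j) \<in> B" for c
    proof -
      have "c \<in> {0, 1, -1}" using UNIV_card_3(1)[OF q] by blast
      then show ?thesis using x by auto
    qed
    then have "x \<in> line_starts B d" by (simp add: line_starts_def)
    moreover have "d \<in> supported I"
    proof -
      have "x \<in> supported I" "(\<lambda>j. x j + d j) \<in> supported I" using x B by auto
      then show ?thesis by (auto simp: supported_def)
    qed
    ultimately show "d = (\<lambda>_. 0)" using x(1) by blast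
  qed
  moreover have "card ?U \<le> (\<Sum>e\<in>supported I - {\<lambda>_. 0}. card (line_starts B e))"
    using I by (intro card_UN_le) simp
  moreover have "card B \<le> card (B - ?U) + card ?U"
  proof -
    have "?U \<subseteq> B" using line_starts_subset by blast
    then show ?thesis using finB by (simp add: card_Diff_subset finite_subset)
  qed
  ultimately show ?thesis by linarith
qed

text \<open>The previous bound is summed over the preimages \<open>B p\<close> of \<open>A\<close>
  under all affine maps \<open>p\<close>. After division by \<open>N^2\<close> it reads as an
  average: expected size on the left, cap set bound plus expected number of lines on the
  right.\<close>

lemma sampling_inequality:
  fixes A :: "('i \<Rightarrow> 'a::{field,finite}) set"
  assumes q: "CARD('a) = 3" and I: "finite I" and A: "A \<subseteq> supported I"
  defines "N \<equiv> card (supported I :: ('i \<Rightarrow> 'a) set)"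
  shows "3 ^ m * card A * N \<le> 3 * card (low_exponents {..<m}) * N\<^sup>2 + (3 ^ m)\<^sup>2 * line_count I A"
proof -
  define V where "V = (supported {..<m} :: (nat \<Rightarrow> 'a) set)"
  define \<Phi> where "\<Phi> = (supported I :: ('i \<Rightarrow> 'a) set) \<times> ({..<m} \<rightarrow>\<^sub>E (supported I :: ('i \<Rightarrow> 'a) set))"
  define B where "B = (\<lambda>p. {c \<in> V. aff_map m (fst p) (snd p) c \<in> A})"
  define L where "L = (\<lambda>c e. {p \<in> \<Phi>. \<forall>a. aff_map m (fst p) (snd p) (\<lambda>i. c i + a * e i) \<in> A})"
  have finV: "finite V" by (simp add: V_def)
  have cV: "card V = 3 ^ m" using q by (simp add: V_def card_supported)
  have fin\<Phi>: "finite \<Phi>" using I by (simp add: \<Phi>_def finite_PiE)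
  have c\<Phi>: "card \<Phi> = N ^ m * N" by (simp add: \<Phi>_def N_def card_cartesian_product card_PiE)
  have Npos: "N > 0" unfolding N_def using I by (simp add: card_supported)
  \<comment> \<open>This moves the condition from the preimage to the map, so that for fixed
    \<open>c\<close> and \<open>e\<close> the maps can be counted.\<close>
  have line_starts_B: "line_starts (B p) e = {c \<in> V. p \<in> L c e}" if "p \<in> \<Phi>" "e \<in> V" for p e
  proof (intro set_eqI iffI)
    fix c assume "c \<in> line_starts (B p) e"
    then show "c \<in> {c \<in> V. p \<in> L c e}"
      using subsetD[OF line_starts_subset[of "B p" e], of c] that by (auto simp: line_starts_def B_def L_def)
  next
    fix c assume c: "c \<in> {c \<in> V. p \<in> L c e}"
    have "(\<lambda>i. c i + a * e i) \<in> V" for a using c that by (auto simp: V_def supported_def)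
    then show "c \<in> line_starts (B p) e" using c by (auto simp: line_starts_def B_def L_def)
  qed
  have "3 ^ m * (card A * N ^ m) = (\<Sum>c\<in>V. card A * N ^ m)" by (simp add: cV)
  also have "\<dots> \<le> (\<Sum>c\<in>V. card {p \<in> \<Phi>. aff_map m (fst p) (snd p) c \<in> A})"
    unfolding N_def \<Phi>_def by (intro sum_mono card_aff_hits_ge I A)
  also have "\<dots> = (\<Sum>p\<in>\<Phi>. card (B p))"
    unfolding B_def using finV fin\<Phi> by (rule sum_card_swap)
  also have "\<dots> \<le> (\<Sum>p\<in>\<Phi>. 3 * card (low_exponents {..<m}) + (\<Sum>e\<in>V - {\<lambda>_. 0}. card (line_starts (B p) e)))"
    unfolding V_def by (intro sum_mono card_le_low_plus_lines q) (auto simp: B_def V_def)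
  also have "\<dots> = N ^ m * N * (3 * card (low_exponents {..<m})) + (\<Sum>p\<in>\<Phi>. \<Sum>e\<in>V - {\<lambda>_. 0}. card (line_starts (B p) e))"
    by (simp add: sum.distrib c\<Phi>)
  also have "(\<Sum>p\<in>\<Phi>. \<Sum>e\<in>V - {\<lambda>_. 0}. card (line_starts (B p) e)) =
      (\<Sum>e\<in>V - {\<lambda>_. 0}. \<Sum>p\<in>\<Phi>. card {c \<in> V. p \<in> L c e})"
    by (subst sum.swap) (simp add: line_starts_B)
  also have "\<dots> = (\<Sum>e\<in>V - {\<lambda>_. 0}. \<Sum>c\<in>V. card {p \<in> \<Phi>. p \<in> L c e})"
    by (intro sum.cong refl sum_card_swap finV fin\<Phi>)
  also have "\<dots> = (\<Sum>e\<in>V - {\<lambda>_. 0}. \<Sum>c\<in>V. card (L c e))"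
    by (intro sum.cong refl arg_cong[where f = card]) (auto simp: L_def)
  finally have *: "3 ^ m * (card A * N ^ m) \<le> N ^ m * N * (3 * card (low_exponents {..<m}))
      + (\<Sum>e\<in>V - {\<lambda>_. 0}. \<Sum>c\<in>V. card (L c e))" .
  have "N * (\<Sum>e\<in>V - {\<lambda>_. 0}. \<Sum>c\<in>V. card (L c e)) = (\<Sum>e\<in>V - {\<lambda>_. 0}. \<Sum>c\<in>V. N * card (L c e))"
    by (simp add: sum_distrib_left)
  also have "\<dots> \<le> (\<Sum>e\<in>V - {\<lambda>_. 0}. \<Sum>c\<in>V. line_count I A * N ^ m)"
    unfolding N_def L_def \<Phi>_def V_def by (intro sum_mono card_aff_lines_le I A) auto
  \<comment> \<open>Admitting \<open>e = 0\<close> only enlarges the sum and makes the number of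
    pairs exactly \<open>(3 ^ m)^2\<close>.\<close>
  also have "\<dots> \<le> (\<Sum>e\<in>V. \<Sum>c\<in>V. line_count I A * N ^ m)"
    using finV by (intro sum_mono2) auto
  also have "\<dots> = (3 ^ m)\<^sup>2 * line_count I A * N ^ m" by (simp add: cV power2_eq_square)
  finally have "N * (\<Sum>e\<in>V - {\<lambda>_. 0}. \<Sum>c\<in>V. card (L c e)) \<le> (3 ^ m)\<^sup>2 * line_count I A * N ^ m" .
  with mult_le_mono2[OF *, of N]
  have "N ^ m * (3 ^ m * card A * N) \<le> N ^ m * (3 * card (low_exponents {..<m}) * N\<^sup>2 + (3 ^ m)\<^sup>2 * line_count I A)"
    by (simp add: algebra_simps power2_eq_square)
  then show ?thesis using Npos by simp
qed

lemma gamma_exponent: "0 < 1 - log 3 gamma_FP" "1 - log 3 gamma_FP \<le> 1"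
  using gamma_FP_bounds by (simp_all add: log_less_iff)

lemma C0_ge_2: "C0 \<ge> 2"
  using gamma_exponent unfolding C0_def by (simp add: field_simps)

lemma supersaturation_weak:
  fixes A :: "('i \<Rightarrow> 'a::{field,finite}) set"
  assumes q: "CARD('a) = 3" and I: "finite I" and A: "A \<subseteq> supported I" "A \<noteq> {}"
  defines "N \<equiv> real (card (supported I :: ('i \<Rightarrow> 'a) set))"
  shows "(real (card A) / N / 6) powr C0 * N\<^sup>2 \<le> real (line_count I A)"
proof -
  define c where "c = 1 - log 3 gamma_FP"
  have c: "0 < c" "c \<le> 1" using gamma_exponent by (auto simp: c_def)
  have finA: "finite A" using A I finite_subset finite_supported by blast
  have N: "N > 0" using I by (simp add: N_def card_supported)
  define \<alpha> where "\<alpha> = real (card A) / N"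
  have "card A \<le> card (supported I :: ('i \<Rightarrow> 'a) set)" using A I by (intro card_mono) auto
  then have \<alpha>: "0 < \<alpha>" "\<alpha> \<le> 1" using N A finA by (auto simp: \<alpha>_def N_def card_gt_0_iff)
  define l where "l = log 3 (6 / \<alpha>)"
  have l0: "l > 0" unfolding l_def using \<alpha> by (subst zero_less_log_cancel_iff) (auto simp: field_simps)
  have l: "3 powr l = 6 / \<alpha>" unfolding l_def using \<alpha> by simp
  \<comment> \<open>This is the least \<open>m\<close> with \<open>3 powr (c * m)\<close> at least
    \<open>6 / \<alpha>\<close>; then the cap set bound \<open>3 * gamma_FP ^ m\<close> is at most
    half of the expected size \<open>\<alpha> * 3 ^ m\<close>.\<close>
  define m where "m = nat \<lceil>l / c\<rceil>"
  have "l / c > 0" using l0 c by simp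
  then have m: "l / c \<le> real m" "real m \<le> l / c + 1" unfolding m_def by linarith+
  define M where "M = (3::real) ^ m"
  have M: "M = 3 powr real m" by (simp add: M_def powr_realpow)
  have Mpos: "M > 0" by (simp add: M_def)
  have "gamma_FP = 3 powr (1 - c)" unfolding c_def using gamma_FP_bounds by simp
  moreover have "gamma_FP ^ m = gamma_FP powr real m"
    using gamma_FP_bounds by (simp add: powr_realpow)
  ultimately have "gamma_FP ^ m = 3 powr ((1 - c) * real m)" by (metis powr_powr)
  also have "\<dots> = M * 3 powr (- (c * real m))"
    by (simp add: M algebra_simps flip: powr_add)
  also have "\<dots> \<le> M * 3 powr (- l)"
    using m(1) c Mpos by (intro mult_left_mono) (auto simp: field_simps)
  also have "\<dots> = M * (\<alpha> / 6)" using l by (simp add: powr_minus)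
  finally have g: "gamma_FP ^ m \<le> M * (\<alpha> / 6)" .
  have few: "real (card (low_exponents {..<m})) \<le> M * (\<alpha> / 6)"
    using card_low_exponents_le_gamma[of "{..<m}"] g by simp
  have "real (3 ^ m * card A * card (supported I :: ('i \<Rightarrow> 'a) set)) \<le>
      real (3 * card (low_exponents {..<m}) * (card (supported I :: ('i \<Rightarrow> 'a) set))\<^sup>2 + (3 ^ m)\<^sup>2 * line_count I A)"
    using sampling_inequality[OF q I A(1), of m] by (simp only: of_nat_le_iff)
  then have "M * real (card A) * N \<le> 3 * real (card (low_exponents {..<m})) * N\<^sup>2 + M\<^sup>2 * real (line_count I A)"
    by (simp add: M_def N_def)
  also have "real (card A) = \<alpha> * N" using N by (simp add: \<alpha>_def)
  also have "3 * real (card (low_exponents {..<m})) * N\<^sup>2 \<le> 3 * (M * (\<alpha> / 6)) * N\<^sup>2"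
    using few by (intro mult_right_mono mult_left_mono) auto
  finally have "M * (\<alpha> / 2 * N\<^sup>2) \<le> M * (M * real (line_count I A))"
    by (simp add: power2_eq_square algebra_simps)
  then have main: "\<alpha> / 2 * N\<^sup>2 \<le> M * real (line_count I A)" using Mpos by simp
  \<comment> \<open>Rounding \<open>m\<close> up costs at most a factor 3; with the factor 2 from
    halving, this is the second source of a 6, matching the one in
    \<open>6 / \<alpha>\<close>.\<close>
  have "M \<le> 3 powr (l / c + 1)" unfolding M using m(2) by simp
  also have "\<dots> = 3 * (6 / \<alpha>) powr (1 / c)"
    by (simp add: powr_add powr_powr flip: l)
  finally have Mle: "M \<le> 3 * (6 / \<alpha>) powr (1 / c)" .
  have inv: "(6 / \<alpha>) powr (1 / c) * (\<alpha> / 6) powr (1 / c) = 1"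
    using \<alpha> by (simp flip: powr_mult)
  have "\<alpha> / 2 * N\<^sup>2 \<le> 3 * (6 / \<alpha>) powr (1 / c) * real (line_count I A)"
    using main Mle by (meson mult_right_mono of_nat_0_le_iff order_trans)
  then have "(\<alpha> / 6) powr (1 / c) * (\<alpha> / 2 * N\<^sup>2) \<le>
      (\<alpha> / 6) powr (1 / c) * (3 * (6 / \<alpha>) powr (1 / c) * real (line_count I A))"
    by (intro mult_left_mono) auto
  also have "\<dots> = 3 * real (line_count I A) * ((6 / \<alpha>) powr (1 / c) * (\<alpha> / 6) powr (1 / c))"
    by (simp only: mult_ac)
  also have "\<dots> = 3 * real (line_count I A)" unfolding inv by simp
  finally have "(\<alpha> / 6) * (\<alpha> / 6) powr (1 / c) * N\<^sup>2 \<le> real (line_count I A)"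
    by (simp add: algebra_simps)
  moreover have "(\<alpha> / 6) powr C0 = (\<alpha> / 6) * (\<alpha> / 6) powr (1 / c)"
    using \<alpha> by (simp add: C0_def c_def powr_add)
  ultimately show ?thesis by (simp add: \<alpha>_def)
qed

section \<open>Cartesian powers and the removal of the constant\<close>

definition set_power :: "'i set \<Rightarrow> nat \<Rightarrow> ('i \<Rightarrow> 'a::zero) set \<Rightarrow> ('i \<times> nat \<Rightarrow> 'a) set" where
  "set_power I k A = {x \<in> supported (I \<times> {..<k}). \<forall>j<k. (\<lambda>i. x (i, j)) \<in> A}"

lemma card_set_power_ge:
  fixes A :: "('i \<Rightarrow> 'a::{zero,finite}) set"
  assumes I: "finite I" and A: "A \<subseteq> supported I"
  shows "card A ^ k \<le> card (set_power I k A)"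
proof -
  let ?f = "\<lambda>g (i, j). if j < k then g j i else (0 :: 'a)"
  have "card ({..<k} \<rightarrow>\<^sub>E A) \<le> card (set_power I k A)"
  proof (rule card_inj_on_le[of ?f])
    show "inj_on ?f ({..<k} \<rightarrow>\<^sub>E A)"
    proof (rule inj_onI)
      fix g g' assume g: "g \<in> {..<k} \<rightarrow>\<^sub>E A" "g' \<in> {..<k} \<rightarrow>\<^sub>E A" and eq: "?f g = ?f g'"
      have "g j i = g' j i" if "j < k" for i j using fun_cong[OF eq, of "(i, j)"] that by simp
      then show "g = g'" by (intro PiE_ext[OF g]) (auto simp: fun_eq_iff)
    qed
    show "?f ` ({..<k} \<rightarrow>\<^sub>E A) \<subseteq> set_power I k A"
    proof (rule image_subsetI)
      fix g assume "g \<in> {..<k} \<rightarrow>\<^sub>E A"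
      then have "\<And>j. j < k \<Longrightarrow> g j \<in> A" by auto
      then show "?f g \<in> set_power I k A" using A by (auto simp: set_power_def supported_def)
    qed
    show "finite (set_power I k A)"
      using I by (auto simp: set_power_def)
  qed
  then show ?thesis by (simp add: card_PiE)
qed

text \<open>A line in the power is a \<open>k\<close>-tuple of lines of \<open>A\<close>. Some of
  these may be degenerate even if the whole is not, which is why \<open>line_count\<close> admits
  the zero direction.\<close>

lemma line_count_set_power_le:
  fixes A :: "('i \<Rightarrow> 'a::{field,finite}) set"
  assumes I: "finite I" and A: "A \<subseteq> supported I"
  shows "line_count (I \<times> {..<k}) (set_power I k A) \<le> line_count I A ^ k"
proof -
  let ?X = "SIGMA d:supported (I \<times> {..<k}). line_starts (set_power I k A) d"
  let ?Y = "SIGMA d:supported I. line_starts A d"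
  let ?f = "\<lambda>p. \<lambda>j\<in>{..<k}. ((\<lambda>i. fst p (i, j)) :: 'i \<Rightarrow> 'a, (\<lambda>i. snd p (i, j)) :: 'i \<Rightarrow> 'a)"
  have finA: "finite A" using A I finite_subset finite_supported by blast
  have finap: "finite (line_starts A d)" for d using finite_subset[OF line_starts_subset finA] .
  have finP: "finite (set_power I k A)" using I by (auto simp: set_power_def)
  have finapP: "finite (line_starts (set_power I k A) d)" for d using finite_subset[OF line_starts_subset finP] .
  have finY: "finite ?Y" using I finap by auto
  have "card ?X \<le> card ({..<k} \<rightarrow>\<^sub>E ?Y)"
  proof (rule card_inj_on_le[of ?f])
    show "inj_on ?f ?X"
    proof (rule inj_onI)
      fix p p' assume p: "p \<in> ?X" "p' \<in> ?X" and eq: "?f p = ?f p'"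
      have sub: "line_starts (set_power I k A) d \<subseteq> supported (I \<times> {..<k})" for d
        using line_starts_subset[of "set_power I k A" d] by (auto simp: set_power_def)
      have z: "fst p \<in> supported (I \<times> {..<k})" "fst p' \<in> supported (I \<times> {..<k})"
        "snd p \<in> supported (I \<times> {..<k})" "snd p' \<in> supported (I \<times> {..<k})"
        using p by (auto intro: subsetD[OF sub])
      have "fst p (i, j) = fst p' (i, j) \<and> snd p (i, j) = snd p' (i, j)" for i j
      proof (cases "j < k")
        case True
        then show ?thesis using fun_cong[OF eq, of j] by (auto simp: fun_eq_iff)
      next
        case False
        then show ?thesis using z by (simp add: supported_def)
      qed
      then show "p = p'" by (auto simp: prod_eq_iff fun_eq_iff)
    qed
    show "?f ` ?X \<subseteq> {..<k} \<rightarrow>\<^sub>E ?Y"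
    proof (rule image_subsetI)
      fix p assume "p \<in> ?X"
      then have d: "fst p \<in> supported (I \<times> {..<k})" and x: "snd p \<in> line_starts (set_power I k A) (fst p)" by auto
      have "(\<lambda>i. fst p (i, j)) \<in> supported I" for j using d by (auto simp: supported_def)
      moreover have "(\<lambda>i. snd p (i, j)) \<in> line_starts A (\<lambda>i. fst p (i, j))" if "j < k" for j
        using x that by (auto simp: line_starts_def set_power_def)
      ultimately show "?f p \<in> {..<k} \<rightarrow>\<^sub>E ?Y" by auto
    qed
    show "finite ({..<k} \<rightarrow>\<^sub>E ?Y)" using finY by (simp add: finite_PiE)
  qed
  then show ?thesis using I finap finapP by (simp add: card_PiE line_count_def)
qed

lemma supersaturation_3:
  fixes A :: "('i \<Rightarrow> 'a::{field,finite}) set"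
  assumes q: "CARD('a) = 3" and I: "finite I" and A: "A \<subseteq> supported I"
  defines "N \<equiv> real (card (supported I :: ('i \<Rightarrow> 'a) set))"
  shows "(real (card A) / N) powr C0 * N\<^sup>2 \<le> real (line_count I A)"
proof (cases "A = {}")
  case True
  then show ?thesis by simp
next
  case False
  have finA: "finite A" using A I finite_subset finite_supported by blast
  have N: "N > 0" using I by (simp add: N_def card_supported)
  define \<alpha> where "\<alpha> = real (card A) / N"
  have \<alpha>: "\<alpha> > 0" using N False finA by (simp add: \<alpha>_def card_gt_0_iff)
  define R where "R = \<alpha> powr C0 * N\<^sup>2"
  define T where "T = real (line_count I A)"
  have R: "R > 0" using \<alpha> N by (simp add: R_def)
  \<comment> \<open>The power has density at least \<open>\<alpha> ^ k\<close> and at most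
    \<open>T ^ k\<close> lines, while the constant 6 is lost only once, whatever \<open>k\<close>
    is.\<close>
  have pow: "(1/6) powr C0 * R ^ k \<le> T ^ k" for k
  proof -
    let ?A = "set_power I k A"
    define N' where "N' = real (card (supported (I \<times> {..<k}) :: ('i \<times> nat \<Rightarrow> 'a) set))"
    have N': "N' = N ^ k" using I by (simp add: N'_def N_def card_supported card_cartesian_product power_mult)
    have cA: "real (card A) ^ k \<le> real (card ?A)"
      using card_set_power_ge[OF I A, of k] by (metis of_nat_le_iff of_nat_power)
    moreover have "card A > 0" using False finA by (simp add: card_gt_0_iff)
    ultimately have ne: "?A \<noteq> {}" by (metis card.empty of_nat_0 not_less of_nat_0_less_iff zero_less_power)
    have "\<alpha> ^ k / 6 \<le> real (card ?A) / N' / 6"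
      using cA N by (simp add: \<alpha>_def N' power_divide divide_right_mono)
    then have "(\<alpha> ^ k / 6) powr C0 * N'\<^sup>2 \<le> (real (card ?A) / N' / 6) powr C0 * N'\<^sup>2"
      using \<alpha> C0_ge_2 by (intro mult_right_mono powr_mono2) auto
    also have "\<dots> \<le> real (line_count (I \<times> {..<k}) ?A)"
      unfolding N'_def using q I ne by (intro supersaturation_weak) (auto simp: set_power_def)
    also have "\<dots> \<le> T ^ k"
      using line_count_set_power_le[OF I A, of k] unfolding T_def by (metis of_nat_le_iff of_nat_power)
    finally have "(\<alpha> ^ k / 6) powr C0 * N'\<^sup>2 \<le> T ^ k" .
    moreover have "(\<alpha> ^ k / 6) powr C0 = (1/6) powr C0 * (\<alpha> powr C0) ^ k"
    proof -
      have "(\<alpha> ^ k) powr C0 = (\<alpha> powr C0) ^ k"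
        using \<alpha> by (simp add: powr_powr mult.commute flip: powr_realpow)
      then show ?thesis using \<alpha> powr_mult[of "1/6" "\<alpha> ^ k" C0] by simp
    qed
    ultimately show ?thesis by (simp add: N' R_def power_mult_distrib mult.assoc flip: power_mult)
      (simp add: mult.commute)
  qed
  have "R \<le> T"
  proof (rule ccontr)
    \<comment> \<open>If \<open>T < R\<close>, the powers of \<open>T / R\<close> tend to 0 and fall
      below the fixed constant.\<close>
    assume "\<not> R \<le> T"
    then have "T / R < 1" using R by simp
    moreover have "(0::real) < (1/6) powr C0" by simp
    ultimately obtain k where "(T / R) ^ k < (1/6) powr C0"
      using real_arch_pow_inv by blast
    then have "T ^ k < (1/6) powr C0 * R ^ k" using R by (simp add: power_divide divide_less_eq)
    with pow[of k] show False by simp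
  qed
  then show ?thesis by (simp add: R_def T_def \<alpha>_def)
qed

section \<open>Convexity of powers\<close>

text \<open>The point 0 has to be included because some directions may have no line in
  \<open>A\<close>. There the claim reduces to \<open>u powr p \<le> u\<close> for \<open>u\<close>
  between 0 and 1.\<close>

lemma convex_on_powr_nonneg:
  fixes p :: real
  assumes p: "p \<ge> 1"
  shows "convex_on {0..} (\<lambda>x. x powr p)"
proof (rule convex_onI)
  fix t x y :: real
  assume t: "0 < t" "t < 1" and x: "x \<in> {0..}" and y: "y \<in> {0..}"
  have le: "u powr p \<le> u" if "0 < u" "u < 1" for u :: real
    using powr_mono'[of 1 p u] that p by simp
  consider "x = 0" | "y = 0" | "x > 0" "y > 0" using x y by force
  then show "((1 - t) *\<^sub>R x + t *\<^sub>R y) powr p \<le> (1 - t) * x powr p + t * y powr p"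
  proof cases
    case 1
    then show ?thesis using le[of t] t y p by (simp add: powr_mult mult_right_mono)
  next
    case 2
    then show ?thesis using le[of "1 - t"] t x p by (simp add: powr_mult mult_right_mono)
  next
    case 3
    then show ?thesis using convex_onD[OF powr_convex[OF p], of t x y] t by simp
  qed
qed simp

lemma power_mean:
  fixes y :: "'b \<Rightarrow> real"
  assumes S: "finite S" "S \<noteq> {}" and y: "\<And>i. i \<in> S \<Longrightarrow> y i \<ge> 0" and p: "p \<ge> 1"
  shows "real (card S) * ((\<Sum>i\<in>S. y i) / real (card S)) powr p \<le> (\<Sum>i\<in>S. y i powr p)"
proof -
  have c: "real (card S) > 0" using S by (simp add: card_gt_0_iff)
  have "(\<Sum>i\<in>S. (1 / real (card S)) *\<^sub>R y i) powr p \<le> (\<Sum>i\<in>S. (1 / real (card S)) * y i powr p)"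
    by (rule convex_on_sum[OF S convex_on_powr_nonneg[OF p]]) (use c y in auto)
  then have "((\<Sum>i\<in>S. y i) / real (card S)) powr p \<le> (\<Sum>i\<in>S. y i powr p) / real (card S)"
    by (simp add: sum_divide_distrib)
  then show ?thesis using c by (simp add: field_simps)
qed

section \<open>Supersaturation over the field with two elements\<close>

lemma UNIV_card_2:
  assumes "CARD('a::{field,finite}) = 2"
  shows "(UNIV :: 'a set) = {0, 1}"
  by (rule sym, rule card_subset_eq) (use assms in \<open>auto simp: card_insert_if\<close>)

text \<open>Over two elements every ordered pair \<open>(x, y)\<close> of points of \<open>A\<close>
  is a line, with start \<open>x\<close> and direction \<open>y - x\<close>.\<close>

lemma supersaturation_2:
  fixes A :: "('i \<Rightarrow> 'a::{field,finite}) set"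
  assumes q: "CARD('a) = 2" and I: "finite I" and A: "A \<subseteq> supported I"
  shows "card A ^ 2 \<le> line_count I A"
proof -
  have finA: "finite A" using A I finite_subset finite_supported by blast
  have fin: "finite (line_starts A d)" for d using finite_subset[OF line_starts_subset finA] .
  let ?f = "\<lambda>(x, y). ((\<lambda>j. y j - x j) :: 'i \<Rightarrow> 'a, x)"
  have "card (A \<times> A) \<le> card (SIGMA d:supported I. line_starts A d)"
  proof (rule card_inj_on_le[of ?f])
    show "inj_on ?f (A \<times> A)" by (auto simp: inj_on_def fun_eq_iff)
    show "?f ` (A \<times> A) \<subseteq> (SIGMA d:supported I. line_starts A d)"
    proof (clarsimp)
      fix x y :: "'i \<Rightarrow> 'a" assume xy: "x \<in> A" "y \<in> A"
      have "x \<in> supported I" "y \<in> supported I" using xy A by auto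
      moreover have "(\<lambda>j. x j + c * (y j - x j)) \<in> A" for c
      proof -
        have "c \<in> {0, 1}" using UNIV_card_2[OF q] by blast
        then show ?thesis using xy by auto
      qed
      ultimately show "(\<lambda>j. y j - x j) \<in> supported I \<and> x \<in> line_starts A (\<lambda>j. y j - x j)"
        by (auto simp: line_starts_def supported_def)
    qed
  qed (use I fin in auto)
  then show ?thesis using I fin by (simp add: card_cartesian_product line_count_def power2_eq_square)
qed

section \<open>Counting affine maps\<close>

text \<open>A map is stored as its base point and its directions; making the directions extensional
  gives each map one representative. Degenerate maps are included.\<close>

definition aff_maps_into :: "'i set \<Rightarrow> nat \<Rightarrow> ('i \<Rightarrow> 'a::semiring_0) set \<Rightarrow> (('i \<Rightarrow> 'a) \<times> (nat \<Rightarrow> 'i \<Rightarrow> 'a)) set" where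
  "aff_maps_into I t A = {p \<in> supported I \<times> ({..<t} \<rightarrow>\<^sub>E supported I). \<forall>c\<in>supported {..<t}. aff_map t (fst p) (snd p) c \<in> A}"

definition lin_indep :: "nat \<Rightarrow> (nat \<Rightarrow> 'i \<Rightarrow> 'a::semiring_0) \<Rightarrow> bool" where
  "lin_indep t v \<longleftrightarrow> (\<forall>c\<in>supported {..<t}. (\<lambda>j. \<Sum>i<t. c i * v i j) = (\<lambda>j. 0) \<longrightarrow> (\<forall>i<t. c i = 0))"

lemma finite_aff_maps_into: "finite I \<Longrightarrow> finite (aff_maps_into I t (A :: ('i \<Rightarrow> 'a::{field,finite}) set))"
  by (auto simp: aff_maps_into_def finite_PiE)

lemma aff_maps_into_Suc:
  fixes A :: "('i \<Rightarrow> 'a::{field,finite}) set"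
  assumes I: "finite I"
  shows "(\<Sum>d\<in>supported I. card (aff_maps_into I t (line_starts A d))) \<le> card (aff_maps_into I (Suc t) A)"
proof -
  let ?X = "SIGMA d:supported I. aff_maps_into I t (line_starts A d)"
  let ?f = "\<lambda>(d, p). (fst p, (snd p)(t := d))"
  have "card ?X \<le> card (aff_maps_into I (Suc t) A)"
  proof (rule card_inj_on_le[of ?f])
    show "inj_on ?f ?X"
    proof (rule inj_onI, clarsimp)
      fix d x v d' v'
      assume h: "(x, v) \<in> aff_maps_into I t (line_starts A d)" "(x, v') \<in> aff_maps_into I t (line_starts A d')"
        and eq: "v(t := d) = v'(t := d')"
      have "v \<in> {..<t} \<rightarrow>\<^sub>E supported I" "v' \<in> {..<t} \<rightarrow>\<^sub>E supported I" using h by (auto simp: aff_maps_into_def)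
      moreover have "v i = v' i" if "i \<in> {..<t}" for i using fun_cong[OF eq, of i] that by simp
      ultimately have "v = v'" by (rule PiE_ext)
      moreover have "d = d'" using fun_cong[OF eq, of t] by simp
      ultimately show "d = d' \<and> v = v'" by blast
    qed
    show "?f ` ?X \<subseteq> aff_maps_into I (Suc t) A"
    proof (clarsimp)
      fix d x v assume d: "d \<in> supported I" and h: "(x, v) \<in> aff_maps_into I t (line_starts A d)"
      have v: "v \<in> {..<t} \<rightarrow>\<^sub>E supported I" and x: "x \<in> supported I" using h by (auto simp: aff_maps_into_def)
      have "v(t := d) \<in> {..<Suc t} \<rightarrow>\<^sub>E supported I"
        using v d by (auto simp: PiE_def extensional_def less_Suc_eq Pi_def)
      moreover have "aff_map (Suc t) x (v(t := d)) c \<in> A" if "c \<in> supported {..<Suc t}" for c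
      proof -
        \<comment> \<open>The first \<open>t\<close> coordinates of \<open>c\<close> give a point of
          \<open>line_starts A d\<close>, and the coordinate \<open>c t\<close> then moves along the
          line in direction \<open>d\<close>.\<close>
        have "c(t := 0) \<in> supported {..<t}" using that by (auto simp: supported_def)
        then have "aff_map t x v (c(t := 0)) \<in> line_starts A d" using h by (auto simp: aff_maps_into_def)
        then have "(\<lambda>j. aff_map t x v (c(t := 0)) j + c t * d j) \<in> A" by (simp add: line_starts_def)
        moreover have "(\<lambda>j. aff_map t x v (c(t := 0)) j + c t * d j) = aff_map (Suc t) x (v(t := d)) c"
          by (simp add: aff_map_def fun_eq_iff add.assoc)
        ultimately show ?thesis by simp
      qed
      ultimately show "(x, v(t := d)) \<in> aff_maps_into I (Suc t) A" using x by (simp add: aff_maps_into_def)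
    qed
    show "finite (aff_maps_into I (Suc t) A)" using I by (rule finite_aff_maps_into)
  qed
  then show ?thesis using I by (simp add: finite_aff_maps_into)
qed

text \<open>In the inductive step \<open>super\<close> bounds the mean density of
  \<open>line_starts A d\<close> over all \<open>d\<close> from below by the power \<open>s\<close>
  of the density of \<open>A\<close>, and \<open>power_mean\<close> carries this through the
  exponent \<open>s ^ t\<close> of the induction hypothesis.\<close>

lemma card_aff_maps_into_ge:
  fixes A :: "('i \<Rightarrow> 'a::{field,finite}) set"
  assumes I: "finite I" and s: "s \<ge> 1" and A: "A \<subseteq> supported I"
  defines "N \<equiv> real (card (supported I :: ('i \<Rightarrow> 'a) set))"
  assumes super: "\<And>A :: ('i \<Rightarrow> 'a) set. A \<subseteq> supported I \<Longrightarrow>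
      (real (card A) / N) powr s * N\<^sup>2 \<le> real (line_count I A)"
  shows "(real (card A) / N) powr (s ^ t) * N ^ (t + 1) \<le> real (card (aff_maps_into I t A))"
  using A
proof (induction t arbitrary: A)
  case 0
  have N: "N > 0" using I by (simp add: N_def card_supported)
  \<comment> \<open>With no directions the only extensional family is constantly
    \<open>undefined\<close>, so a map is just a point of \<open>A\<close>.\<close>
  have "aff_maps_into I 0 A = A \<times> {\<lambda>_. undefined}"
    using 0 by (auto simp: aff_maps_into_def aff_map_def supported_def)
  then show ?case using N by (simp add: card_cartesian_product)
next
  case (Suc t)
  have N: "N > 0" using I by (simp add: N_def card_supported)
  define a where "a = (\<lambda>d. real (card (line_starts A d)) / N)"
  have p: "s ^ t \<ge> 1" using s by simp
  have ne: "supported I \<noteq> ({} :: ('i \<Rightarrow> 'a) set)" using zero_in_supported by blast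
  have "(real (card A) / N) powr s \<le> real (line_count I A) / N\<^sup>2"
    using super[OF Suc.prems] N by (simp add: field_simps)
  also have "\<dots> = (\<Sum>d\<in>supported I. a d) / N"
    by (simp add: a_def line_count_def power2_eq_square flip: sum_divide_distrib)
  finally have "((real (card A) / N) powr s) powr (s ^ t) \<le> ((\<Sum>d\<in>supported I. a d) / N) powr (s ^ t)"
    using p by (intro powr_mono2) auto
  then have "(real (card A) / N) powr (s ^ Suc t) * N ^ (Suc t + 1)
      \<le> N * ((\<Sum>d\<in>supported I. a d) / N) powr (s ^ t) * N ^ (t + 1)"
    using N by (simp add: powr_powr mult_ac)
  also have "N * ((\<Sum>d\<in>supported I. a d) / N) powr (s ^ t) \<le> (\<Sum>d\<in>supported I. a d powr (s ^ t))"
    unfolding N_def by (rule power_mean) (use I p ne N in \<open>auto simp: a_def\<close>)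
  then have "N * ((\<Sum>d\<in>supported I. a d) / N) powr (s ^ t) * N ^ (t + 1)
      \<le> (\<Sum>d\<in>supported I. a d powr (s ^ t)) * N ^ (t + 1)"
    using N by (intro mult_right_mono) auto
  also have "\<dots> = (\<Sum>d\<in>supported I. a d powr (s ^ t) * N ^ (t + 1))" by (rule sum_distrib_right)
  also have "\<dots> \<le> (\<Sum>d\<in>supported I. real (card (aff_maps_into I t (line_starts A d))))"
    unfolding a_def using line_starts_subset Suc.prems by (intro sum_mono Suc.IH) blast
  also have "\<dots> \<le> real (card (aff_maps_into I (Suc t) A))"
    using aff_maps_into_Suc[OF I, of t A] by (simp flip: of_nat_sum)
  finally show ?case .
qed

text \<open>A union bound over the \<open>CARD('a) ^ t - 1\<close> nonzero relations
  \<open>e\<close>.\<close>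

lemma card_dependent_aff_maps_le:
  fixes A :: "('i \<Rightarrow> 'a::{field,finite}) set"
  assumes I: "finite I" and A: "A \<subseteq> supported I"
  shows "card {p \<in> aff_maps_into I t A. \<not> lin_indep t (snd p)} \<le> (CARD('a) ^ t - 1) * card A ^ t"
proof -
  let ?Z = "supported {..<t} - {\<lambda>_. 0} :: (nat \<Rightarrow> 'a) set"
  let ?R = "\<lambda>e. {p \<in> aff_maps_into I t A. \<forall>j. (\<Sum>i<t. e i * snd p i j) = 0}"
  have finA: "finite A" using A I finite_subset finite_supported by blast
  have each: "card (?R e) \<le> card A ^ t" if e: "e \<in> ?Z" for e
  proof -
    from e obtain i0 where i0: "i0 < t" "e i0 \<noteq> 0" by (auto simp: supported_def fun_eq_iff)
    \<comment> \<open>The relation recovers \<open>snd p i0\<close> from the other directions, so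
      slot \<open>i0\<close> is free to record the base point; the other slots record the images of
      unit vectors.\<close>
    let ?f = "\<lambda>p. \<lambda>i\<in>{..<t}. if i = i0 then fst p else (\<lambda>j. fst p j + snd p i j)"
    have "card (?R e) \<le> card ({..<t} \<rightarrow>\<^sub>E A)"
    proof (rule card_inj_on_le[of ?f])
      show "inj_on ?f (?R e)"
      proof (rule inj_onI)
        fix p p' assume p: "p \<in> ?R e" "p' \<in> ?R e" and eq: "?f p = ?f p'"
        have x: "fst p = fst p'" using fun_cong[OF eq, of i0] i0 by simp
        have "snd p = snd p'"
        proof (rule combination_determines[where e = e, OF _ _ i0])
          show "snd p \<in> {..<t} \<rightarrow>\<^sub>E supported I" "snd p' \<in> {..<t} \<rightarrow>\<^sub>E supported I"
            using p by (auto simp: aff_maps_into_def)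
          show "snd p i = snd p' i" if "i < t" "i \<noteq> i0" for i
            using fun_cong[OF eq, of i] that x by (simp add: fun_eq_iff)
          show "(\<Sum>i<t. e i * snd p i j) = (\<Sum>i<t. e i * snd p' i j)" for j
            using p by simp
        qed
        with x show "p = p'" by (simp add: prod_eq_iff)
      qed
      show "?f ` ?R e \<subseteq> {..<t} \<rightarrow>\<^sub>E A"
      proof (rule image_subsetI)
        fix p assume "p \<in> ?R e"
        then have h: "aff_map t (fst p) (snd p) c \<in> A" if "c \<in> supported {..<t}" for c
          using that by (auto simp: aff_maps_into_def)
        have "fst p \<in> A" using h[OF zero_in_supported] by (simp add: aff_map_def)
        moreover have "(\<lambda>j. fst p j + snd p i j) \<in> A" if "i < t" for i
        proof -
          have "(\<Sum>k<t. (if k = i then 1 else 0) * snd p k j) = snd p i j" for j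
            using that by (simp add: if_distrib[where f = "\<lambda>u. u * _"] cong: if_cong)
          then show ?thesis
            using h[of "\<lambda>k. if k = i then 1 else 0"] that by (simp add: supported_def aff_map_def)
        qed
        ultimately show "?f p \<in> {..<t} \<rightarrow>\<^sub>E A" by auto
      qed
      show "finite ({..<t} \<rightarrow>\<^sub>E A)" using finA by (simp add: finite_PiE)
    qed
    then show ?thesis by (simp add: card_PiE)
  qed
  have finZ: "finite ?Z" by simp
  have "{p \<in> aff_maps_into I t A. \<not> lin_indep t (snd p)} \<subseteq> (\<Union>e\<in>?Z. ?R e)"
    by (auto simp: lin_indep_def fun_eq_iff)
  then have "card {p \<in> aff_maps_into I t A. \<not> lin_indep t (snd p)} \<le> card (\<Union>e\<in>?Z. ?R e)"
    using I by (intro card_mono) (auto simp: finite_aff_maps_into)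
  also have "\<dots> \<le> (\<Sum>e\<in>?Z. card (?R e))" using finZ by (rule card_UN_le)
  also have "\<dots> \<le> (\<Sum>e\<in>?Z. card A ^ t)" by (intro sum_mono each)
  also have "\<dots> = (CARD('a) ^ t - 1) * card A ^ t" by (simp add: card_Diff_singleton card_supported)
  finally show ?thesis .
qed

section \<open>From affine maps to affine subspaces\<close>

definition unit_vec :: "nat \<Rightarrow> nat \<Rightarrow> 'a::zero_neq_one" where
  "unit_vec i = (\<lambda>k. if k = i then 1 else 0)"

lemma unit_vec_in_vecs: "i < t \<Longrightarrow> unit_vec i \<in> vecs t"
  by (simp add: unit_vec_def vecs_def)

lemma aff_map_unit_vec:
  fixes x :: "'i \<Rightarrow> 'a::field"
  assumes "i < t"
  shows "aff_map t x v (unit_vec i) = (\<lambda>j. x j + v i j)"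
  using assms by (simp add: aff_map_def unit_vec_def if_distrib[where f = "\<lambda>u. u * _"] cong: if_cong)

lemma aff_map_zero: "aff_map t x v (\<lambda>_. 0) = x"
  by (simp add: aff_map_def)

lemma inj_on_aff_map:
  fixes x :: "'i \<Rightarrow> 'a::field"
  assumes "lin_indep t v"
  shows "inj_on (aff_map t x v) (vecs t)"
proof (rule inj_onI)
  fix c c' assume c: "c \<in> vecs t" "c' \<in> vecs t" and eq: "aff_map t x v c = aff_map t x v c'"
  let ?d = "\<lambda>i. c i - c' i"
  have d: "?d \<in> supported {..<t}" using c by (auto simp: vecs_def supported_def)
  have sum: "(\<lambda>j. \<Sum>i<t. ?d i * v i j) = (\<lambda>j. 0)"
    using eq by (simp add: aff_map_def fun_eq_iff left_diff_distrib sum_subtractf)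
  have z: "\<forall>i<t. ?d i = 0"
    by (rule mp[OF bspec[OF assms[unfolded lin_indep_def] d] sum])
  show "c = c'"
  proof
    fix i
    show "c i = c' i" using z c by (cases "i < t") (simp_all add: vecs_def)
  qed
qed

lemma finite_vecs [simp]: "finite (vecs n :: (nat \<Rightarrow> 'a::{zero,finite}) set)"
  by (simp add: vecs_eq_supported)

lemma finite_Aut_aff: "finite (Aut_aff t :: ((nat \<Rightarrow> 'a::{field,finite}) \<Rightarrow> (nat \<Rightarrow> 'a)) set)"
proof (rule finite_subset)
  show "(Aut_aff t :: ((nat \<Rightarrow> 'a) \<Rightarrow> (nat \<Rightarrow> 'a)) set) \<subseteq> vecs t \<rightarrow>\<^sub>E vecs t"
    unfolding Aut_aff_def by (auto simp: PiE_def dest: bij_betwE)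
qed (simp add: finite_PiE)

text \<open>Makes \<open>card (Aut_aff t)\<close> positive, so that dividing by it is
  legitimate.\<close>

lemma restrict_id_in_Aut_aff:
  "restrict id (vecs t) \<in> (Aut_aff t :: ((nat \<Rightarrow> 'a::field) \<Rightarrow> (nat \<Rightarrow> 'a)) set)"
proof -
  have "x = (\<lambda>j. if j < t then 0 + (\<Sum>i<t. (if j = i then 1 else 0) * x i) else 0)"
    if "x \<in> vecs t" for x :: "nat \<Rightarrow> 'a"
    using that by (auto simp: vecs_def fun_eq_iff if_distrib[where f = "\<lambda>u. u * _"] cong: if_cong)
  moreover have "(\<lambda>_. 0 :: 'a) \<in> vecs t" by (simp add: vecs_def)
  moreover have "bij_betw (restrict id (vecs t)) (vecs t) (vecs t :: (nat \<Rightarrow> 'a) set)"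
    by (simp add: bij_betw_def inj_on_def)
  ultimately show ?thesis unfolding Aut_aff_def
    by (auto intro!: exI[of _ "\<lambda>j i. if j = i then 1 else 0"] exI[of _ "\<lambda>_. 0"])
qed

text \<open>Fixing one parametrization \<open>p0\<close> of \<open>S\<close>, any other
  \<open>p\<close> differs from it by the change of coordinates \<open>h p\<close>, which is an
  affine bijection and determines \<open>p\<close>.\<close>

lemma card_parametrizations_le:
  fixes S :: "('i \<Rightarrow> 'a::{field,finite}) set"
  assumes X: "\<And>p. p \<in> X \<Longrightarrow> snd p \<in> {..<t} \<rightarrow>\<^sub>E Y \<and> lin_indep t (snd p) \<and> aff_map t (fst p) (snd p) ` vecs t = S"
  shows "card X \<le> card (Aut_aff t :: ((nat \<Rightarrow> 'a) \<Rightarrow> (nat \<Rightarrow> 'a)) set)"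
proof (cases "X = {}")
  case False
  then obtain p0 where p0: "p0 \<in> X" by blast
  let ?g = "\<lambda>p. aff_map t (fst p) (snd p)"
  define x where "x = fst p0"
  define v where "v = snd p0"
  have bij: "bij_betw (?g p) (vecs t) S" if "p \<in> X" for p
    using X[OF that] inj_on_aff_map by (auto simp: bij_betw_def)
  define h where "h = (\<lambda>p. restrict (inv_into (vecs t) (?g p0) \<circ> ?g p) (vecs t))"
  have F: "?g p0 (h p c) = ?g p c" if "p \<in> X" "c \<in> vecs t" for p c
  proof -
    have "?g p c \<in> ?g p0 ` vecs t" using bij[OF p0] bij[OF that(1)] that(2) by (auto simp: bij_betw_def)
    then show ?thesis using that by (simp add: h_def f_inv_into_f)
  qed
  have Feq: "h p c = z" if "p \<in> X" "c \<in> vecs t" "z \<in> vecs t" "?g p0 z = ?g p c" for p c z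
    using that bij[OF p0] by (simp add: h_def bij_betw_def flip: that(4))
  have zero: "(\<lambda>_. 0 :: 'a) \<in> vecs t" by (simp add: vecs_def)
  show ?thesis
  proof (rule card_inj_on_le[of h])
    show "inj_on h X"
    proof (rule inj_onI)
      fix p p' assume p: "p \<in> X" "p' \<in> X" and eq: "h p = h p'"
      have same: "?g p c = ?g p' c" if "c \<in> vecs t" for c
        using F[OF p(1) that] F[OF p(2) that] eq by simp
      have 1: "fst p = fst p'" using same[OF zero] by (simp add: aff_map_zero)
      have "snd p = snd p'"
      proof (rule PiE_ext)
        show "snd p \<in> {..<t} \<rightarrow>\<^sub>E Y" "snd p' \<in> {..<t} \<rightarrow>\<^sub>E Y" using X p by auto
        fix i assume "i \<in> {..<t}"
        then have "i < t" by simp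
        then show "snd p i = snd p' i"
          using same[OF unit_vec_in_vecs, of i] 1 by (simp add: aff_map_unit_vec fun_eq_iff)
      qed
      with 1 show "p = p'" by (simp add: prod_eq_iff)
    qed
    show "h ` X \<subseteq> Aut_aff t"
    proof (rule image_subsetI)
      fix p assume p: "p \<in> X"
      define y where "y = fst p"
      define w where "w = snd p"
      have gp0: "?g p0 = aff_map t x v" and gp: "?g p = aff_map t y w" by (simp_all add: x_def v_def y_def w_def)
      have bF: "bij_betw (h p) (vecs t) (vecs t)"
        using bij_betw_trans[OF bij[OF p] bij_betw_inv_into[OF bij[OF p0]]]
        unfolding h_def by (subst bij_betw_cong) auto
      define b where "b = h p (\<lambda>_. 0)"
      \<comment> \<open>An affine map is read off from its values: the image of zero is the
        translation, and the images of unit vectors minus it are the columns.\<close>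
      define M where "M = (\<lambda>j i. h p (unit_vec i) j - b j)"
      have b: "b \<in> vecs t" unfolding b_def using bF zero by (rule bij_betw_apply)
      have xb: "x j + (\<Sum>k<t. b k * v k j) = y j" for j
        using fun_cong[OF F[OF p zero], of j] unfolding gp0 gp b_def[symmetric] aff_map_zero
        by (simp add: aff_map_def)
      have xM: "(\<Sum>k<t. M k i * v k j) = w i j" if "i < t" for i j
      proof -
        have "x j + (\<Sum>k<t. h p (unit_vec i) k * v k j) = y j + w i j"
          using fun_cong[OF F[OF p unit_vec_in_vecs[OF that]], of j]
          unfolding gp0 gp aff_map_unit_vec[OF that] by (simp add: aff_map_def)
        also have "\<dots> = x j + ((\<Sum>k<t. b k * v k j) + w i j)"
          using xb[of j] by (simp add: add.assoc[symmetric])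
        finally have "(\<Sum>k<t. h p (unit_vec i) k * v k j) = (\<Sum>k<t. b k * v k j) + w i j"
          by (simp only: add_left_cancel)
        then show ?thesis by (simp add: M_def left_diff_distrib sum_subtractf)
      qed
      have "h p c = (\<lambda>j. if j < t then b j + (\<Sum>i<t. M j i * c i) else 0)" (is "_ = ?z")
        if c: "c \<in> vecs t" for c
      \<comment> \<open>The parametrization \<open>p0\<close> is injective, so it suffices that
        \<open>p0\<close> sends the candidate \<open>?z\<close> to the same point as
        \<open>p\<close> sends \<open>c\<close>.\<close>
      proof (rule Feq[OF p c])
        show "?z \<in> vecs t" by (simp add: vecs_def)
        have "aff_map t x v ?z j = aff_map t y w c j" for j
        proof -
          have "aff_map t x v ?z j = x j + (\<Sum>k<t. (b k + (\<Sum>i<t. M k i * c i)) * v k j)"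
            by (simp add: aff_map_def)
          also have "\<dots> = (x j + (\<Sum>k<t. b k * v k j)) + (\<Sum>k<t. \<Sum>i<t. M k i * c i * v k j)"
            by (simp add: distrib_right sum.distrib sum_distrib_right)
          also have "(\<Sum>k<t. \<Sum>i<t. M k i * c i * v k j) = (\<Sum>i<t. \<Sum>k<t. M k i * c i * v k j)"
            by (rule sum.swap)
          also have "\<dots> = (\<Sum>i<t. c i * (\<Sum>k<t. M k i * v k j))"
            by (simp add: sum_distrib_left mult_ac)
          also have "\<dots> = (\<Sum>i<t. c i * w i j)" by (intro sum.cong) (simp_all add: xM)
          finally show ?thesis by (simp add: xb aff_map_def)
        qed
        then show "?g p0 ?z = ?g p c" unfolding gp0 gp by blast
      qed
      then have "\<exists>M b. b \<in> vecs t \<and>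
          (\<forall>c\<in>vecs t. h p c = (\<lambda>j. if j < t then b j + (\<Sum>i<t. M j i * c i) else 0))"
        using b by (intro exI[of _ M] exI[of _ b] conjI ballI)
      moreover have "h p \<in> extensional (vecs t)" by (simp add: h_def)
      ultimately show "h p \<in> Aut_aff t"
        unfolding Aut_aff_def using bF by simp
    qed
  qed (rule finite_Aut_aff)
qed simp

lemma finite_affine_subspaces_in:
  "A \<subseteq> vecs n \<Longrightarrow> finite {S \<in> affine_subspaces n t. S \<subseteq> (A :: (nat \<Rightarrow> 'a::{field,finite}) set)}"
  by (rule finite_subset[of _ "Pow A"]) (auto intro: finite_subset[OF _ finite_vecs])

text \<open>The injective maps are grouped by their image.\<close>

lemma card_injective_aff_maps_le:
  fixes A :: "(nat \<Rightarrow> 'a::{field,finite}) set"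
  assumes A: "A \<subseteq> vecs n"
  shows "card {p \<in> aff_maps_into {..<n} t A. lin_indep t (snd p)} \<le>
    card {S \<in> affine_subspaces n t. S \<subseteq> A} * card (Aut_aff t :: ((nat \<Rightarrow> 'a) \<Rightarrow> (nat \<Rightarrow> 'a)) set)"
proof -
  let ?J = "{p \<in> aff_maps_into {..<n} t A. lin_indep t (snd p)}"
  let ?S = "{S \<in> affine_subspaces n t. S \<subseteq> A}"
  let ?X = "\<lambda>S. {p \<in> ?J. aff_map t (fst p) (snd p) ` vecs t = S}"
  have "aff_map t (fst p) (snd p) ` vecs t \<in> ?S" if p: "p \<in> ?J" for p
  proof -
    obtain x v where pp: "p = (x, v)" by force
    have "aff_map t x v ` vecs t \<subseteq> A" using p by (auto simp: pp aff_maps_into_def vecs_eq_supported)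
    moreover have "aff_map t x v ` vecs t \<in> affine_subspaces n t"
    proof -
      have "x \<in> vecs n" "\<forall>i<t. v i \<in> vecs n" using p by (auto simp: pp aff_maps_into_def vecs_eq_supported)
      moreover have "\<forall>c\<in>vecs t. (\<lambda>j. \<Sum>i<t. c i * v i j) = (\<lambda>j. 0) \<longrightarrow> (\<forall>i<t. c i = 0)"
        using p by (simp add: pp lin_indep_def vecs_eq_supported)
      moreover have "aff_map t x v ` vecs t = {(\<lambda>j. x j + (\<Sum>i<t. c i * v i j)) | c. c \<in> vecs t}"
        by (auto simp: aff_map_def)
      ultimately show ?thesis unfolding affine_subspaces_def by blast
    qed
    ultimately show ?thesis by (simp add: pp)
  qed
  then have sub: "?J \<subseteq> (\<Union>S\<in>?S. ?X S)" by blast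
  have "card ?J \<le> card (\<Union>S\<in>?S. ?X S)"
    by (rule card_mono[OF _ sub])
      (rule finite_subset[of _ "aff_maps_into {..<n} t A"], auto simp: finite_aff_maps_into)
  also have "\<dots> \<le> (\<Sum>S\<in>?S. card (?X S))"
    using finite_affine_subspaces_in[OF A] by (rule card_UN_le)
  also have "\<dots> \<le> (\<Sum>S\<in>?S. card (Aut_aff t :: ((nat \<Rightarrow> 'a) \<Rightarrow> (nat \<Rightarrow> 'a)) set))"
    by (intro sum_mono card_parametrizations_le[where Y = "supported {..<n}"]) (simp add: aff_maps_into_def mem_Times_iff)
  finally show ?thesis by simp
qed

section \<open>Lower bounds for the number of affine subspaces\<close>

lemma sigma_supersaturation:
  fixes A :: "('i \<Rightarrow> 'a::{field,finite}) set"
  assumes q: "CARD('a) = q" "q \<in> {2, 3}" and I: "finite I" and A: "A \<subseteq> supported I"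
  defines "N \<equiv> real (card (supported I :: ('i \<Rightarrow> 'a) set))"
  shows "(real (card A) / N) powr sigma q * N\<^sup>2 \<le> real (line_count I A)"
proof (cases "q = 2")
  case True
  have N: "N > 0" using I by (simp add: N_def card_supported)
  have "real (card A ^ 2) \<le> real (line_count I A)"
    using supersaturation_2[OF _ I A] q True by (simp only: of_nat_le_iff)
  moreover have "(real (card A) / N) powr 2 = (real (card A) / N)\<^sup>2"
    using N by (cases "card A = 0") (simp_all add: powr_numeral)
  ultimately show ?thesis using True N by (simp add: sigma_def power_divide)
next
  case False
  then show ?thesis using supersaturation_3[OF _ I A] q by (simp add: sigma_def N_def)
qed

lemma sigma_ge_2: "sigma q \<ge> 2"
  using C0_ge_2 by (simp add: sigma_def)

text \<open>Keeps the denominator \<open>sigma q ^ t - t\<close> positive.\<close>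

lemma sigma_power_gt: "sigma q ^ t > real t"
proof -
  have "real t < real (2 ^ t)" by (simp only: of_nat_less_iff less_exp)
  also have "\<dots> \<le> sigma q ^ t" using sigma_ge_2 by (simp add: power_mono)
  finally show ?thesis .
qed

lemma affine_subspaces_count:
  fixes A :: "(nat \<Rightarrow> 'a::{field,finite}) set"
  assumes q: "CARD('a) = q" "q \<in> {2, 3}" and A: "A \<subseteq> vecs n" "A \<noteq> {}"
  defines "N \<equiv> real q ^ n"
  shows "real (card {S \<in> affine_subspaces n t. S \<subseteq> A}) >
    ((real (card A) / N) powr (sigma q ^ t) * N ^ (t + 1) - real q ^ t * real (card A) ^ t)
      / real (card (Aut_aff t :: ((nat \<Rightarrow> 'a) \<Rightarrow> (nat \<Rightarrow> 'a)) set))"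
proof -
  let ?H = "aff_maps_into {..<n} t A"
  let ?aut = "card (Aut_aff t :: ((nat \<Rightarrow> 'a) \<Rightarrow> (nat \<Rightarrow> 'a)) set)"
  have A': "A \<subseteq> supported {..<n}" using A by (simp add: vecs_eq_supported)
  have N: "N = real (card (supported {..<n} :: (nat \<Rightarrow> 'a) set))" using q by (simp add: N_def card_supported)
  have cA: "card A > 0" using A finite_subset[OF A(1)] by (simp add: card_gt_0_iff)
  have aut: "?aut > 0" using finite_Aut_aff restrict_id_in_Aut_aff by (auto simp: card_gt_0_iff)
  have "(real (card A) / N) powr (sigma q ^ t) * N ^ (t + 1) \<le> real (card ?H)"
    unfolding N by (rule card_aff_maps_into_ge[OF _ _ A' sigma_supersaturation[OF q]])
      (use sigma_ge_2[of q] in auto)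
  also have "card ?H = card {p \<in> ?H. lin_indep t (snd p)} + card {p \<in> ?H. \<not> lin_indep t (snd p)}"
    by (subst card_Un_disjoint[symmetric]) (auto simp: finite_aff_maps_into intro!: arg_cong[where f = card])
  also have "\<dots> \<le> card {S \<in> affine_subspaces n t. S \<subseteq> A} * ?aut + (q ^ t - 1) * card A ^ t"
    using card_injective_aff_maps_le[OF A(1)] card_dependent_aff_maps_le[OF _ A'] q(1) by (intro add_mono) auto
  \<comment> \<open>Strictness arises here, from replacing \<open>q ^ t - 1\<close> by
    \<open>q ^ t\<close>; this needs \<open>A\<close> nonempty.\<close>
  also have "\<dots> < card {S \<in> affine_subspaces n t. S \<subseteq> A} * ?aut + q ^ t * card A ^ t"
    using cA q(2) by auto
  finally have "(real (card A) / N) powr (sigma q ^ t) * N ^ (t + 1) <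
      real (card {S \<in> affine_subspaces n t. S \<subseteq> A}) * real ?aut + real q ^ t * real (card A) ^ t"
    by simp
  then show ?thesis using aut by (simp add: divide_less_eq)
qed

lemma affine_subspaces_count_D:
  fixes A :: "(nat \<Rightarrow> 'a::{field,finite}) set"
  assumes q: "CARD('a) = q" "q \<in> {2, 3}" and A: "A \<subseteq> vecs n" and D: "D > 0"
    and cA: "real (card A) = D * real q powr ((1 - 1 / (sigma q ^ t - real t)) * real n)"
  defines "N \<equiv> real q ^ n"
  shows "real (card {S \<in> affine_subspaces n t. S \<subseteq> A}) >
    (1 - real q ^ t / D powr (sigma q ^ t - real t)) * (real (card A) / N) powr (sigma q ^ t) * N ^ (t + 1)
      / real (card (Aut_aff t :: ((nat \<Rightarrow> 'a) \<Rightarrow> (nat \<Rightarrow> 'a)) set))"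
proof -
  define \<kappa> where "\<kappa> = sigma q ^ t - real t"
  have \<kappa>: "\<kappa> > 0" using sigma_power_gt by (simp add: \<kappa>_def)
  have q0: "real q > 0" using q(2) by auto
  have N: "N > 0" "N = real q powr real n" using q0 by (simp_all add: N_def powr_realpow)
  define \<alpha> where "\<alpha> = real (card A) / N"
  have "real (card A) > 0" using cA D q0 by simp
  then have ne: "A \<noteq> {}" and \<alpha>: "\<alpha> > 0" using N by (auto simp: \<alpha>_def)
  have "\<alpha> = D * real q powr (- (real n / \<kappa>))"
    unfolding \<alpha>_def cA N(2) \<kappa>_def[symmetric] using q0
    by (simp add: left_diff_distrib powr_diff powr_minus field_simps)
  then have "\<alpha> powr \<kappa> = D powr \<kappa> * real q powr (- real n)"
    using D \<kappa> by (simp add: powr_mult powr_powr)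
  \<comment> \<open>The normalization by \<open>D\<close> is made for this identity: it shows that
    the degenerate term \<open>q ^ t * card A ^ t\<close> is the fraction
    \<open>q ^ t / D powr \<kappa>\<close> of the main term.\<close>
  then have "\<alpha> powr \<kappa> = D powr \<kappa> / N" by (simp add: N(2) powr_minus field_simps)
  moreover have "\<alpha> powr (sigma q ^ t) = \<alpha> powr \<kappa> * \<alpha> ^ t"
    using \<alpha> by (simp add: \<kappa>_def flip: powr_realpow powr_add)
  ultimately have "real q ^ t / D powr \<kappa> * \<alpha> powr (sigma q ^ t) * N ^ (t + 1) = real q ^ t * (\<alpha> * N) ^ t"
    using D N(1) by (simp add: field_simps power_mult_distrib)
  then have "(1 - real q ^ t / D powr \<kappa>) * \<alpha> powr (sigma q ^ t) * N ^ (t + 1) =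
      \<alpha> powr (sigma q ^ t) * N ^ (t + 1) - real q ^ t * real (card A) ^ t"
    using N(1) by (simp add: left_diff_distrib \<alpha>_def)
  then show ?thesis
    using affine_subspaces_count[OF q A ne, of t] unfolding \<alpha>_def \<kappa>_def N_def by simp
qed

section \<open>The extremal bound\<close>

lemma ex_aff_attained:
  "\<exists>A \<subseteq> vecs n. card A = ex_aff TYPE('a::{field,finite}) n t
     \<and> \<not> (\<exists>S \<in> affine_subspaces n t. S \<subseteq> (A :: (nat \<Rightarrow> 'a) set))"
proof -
  let ?P = "\<lambda>A :: (nat \<Rightarrow> 'a) set. A \<subseteq> vecs n \<and> \<not> (\<exists>S \<in> affine_subspaces n t. S \<subseteq> A)"
  have "finite {A :: (nat \<Rightarrow> 'a) set. ?P A}"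
    by (rule finite_subset[of _ "Pow (vecs n)"]) auto
  then have fin: "finite {card A | A. ?P A}" by (simp add: setcompr_eq_image)
  \<comment> \<open>The maximum is over a nonempty set: affine subspaces are nonempty, so the empty
    set qualifies.\<close>
  have "S \<noteq> {}" if "S \<in> affine_subspaces n t" for S :: "(nat \<Rightarrow> 'a) set"
    using that by (auto simp: affine_subspaces_def vecs_def)
  then have "?P {}" by auto
  then have "{card A | A. ?P A} \<noteq> {}" by blast
  from Max_in[OF fin this] show ?thesis unfolding ex_aff_def by auto
qed

text \<open>An extremal set contains no subspace, so the lower bound for their number must be
  negative. This forces \<open>D powr \<kappa> < q ^ t\<close>, which bounds the size of the
  set.\<close>

lemma ex_aff_less:
  assumes q: "CARD('a::{field,finite}) = q" "q \<in> {2, 3}"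
  shows "real (ex_aff TYPE('a) n t)
    < real q powr (real n - (real n - real t) / (sigma q ^ t - real t))"
proof -
  obtain A :: "(nat \<Rightarrow> 'a) set" where A: "A \<subseteq> vecs n" "card A = ex_aff TYPE('a) n t"
    and no: "\<not> (\<exists>S \<in> affine_subspaces n t. S \<subseteq> A)"
    using ex_aff_attained[where 'a = 'a, of n t] by (elim exE conjE)
  from no have none: "{S \<in> affine_subspaces n t. S \<subseteq> A} = {}" by simp
  have q0: "real q > 0" using q(2) by auto
  show ?thesis
  \<comment> \<open>For \<open>t = 0\<close> the extremal set is empty and gives no positive
    \<open>D\<close>.\<close>
  proof (cases "card A = 0")
    case True
    then show ?thesis using A(2) q0 by simp
  next
    case False
    define \<kappa> where "\<kappa> = sigma q ^ t - real t"
    have \<kappa>: "\<kappa> > 0" using sigma_power_gt by (simp add: \<kappa>_def)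
    let ?B = "real q powr ((1 - 1 / \<kappa>) * real n)"
    define D where "D = real (card A) / ?B"
    have D: "D > 0" and cA: "real (card A) = D * ?B" using False q0 by (simp_all add: D_def)
    let ?c = "(real (card A) / real q ^ n) powr (sigma q ^ t) * (real q ^ n) ^ (t + 1)
      / real (card (Aut_aff t :: ((nat \<Rightarrow> 'a) \<Rightarrow> (nat \<Rightarrow> 'a)) set))"
    have "(1 - real q ^ t / D powr \<kappa>) * ?c < 0"
      using affine_subspaces_count_D[OF q A(1) D, of t] cA none by (simp add: \<kappa>_def mult.assoc)
    moreover have "?c \<ge> 0" by simp
    ultimately have "1 - real q ^ t / D powr \<kappa> < 0" by (simp only: mult_less_0_iff) linarith
    then have *: "D powr \<kappa> < real q ^ t" using D by (simp add: field_simps)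
    have "D = (D powr \<kappa>) powr (1 / \<kappa>)" using D \<kappa> by (simp add: powr_powr)
    also have "\<dots> < (real q ^ t) powr (1 / \<kappa>)" using * \<kappa> by (intro powr_less_mono2) auto
    also have "\<dots> = real q powr (real t / \<kappa>)"
      using q0 by (simp add: powr_powr flip: powr_realpow)
    finally have "real (card A) < real q powr (real t / \<kappa>) * ?B"
      using q0 unfolding cA by (intro mult_strict_right_mono) auto
    also have "\<dots> = real q powr (real n - (real n - real t) / \<kappa>)"
    proof -
      have "real t / \<kappa> + (1 - 1 / \<kappa>) * real n = real n - (real n - real t) / \<kappa>"
        by (simp add: left_diff_distrib diff_divide_distrib)
      then show ?thesis by (simp flip: powr_add)
    qed
    finally show ?thesis using A(2) by (simp add: \<kappa>_def)
  qed
qed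

theorem theorem4p2:
  fixes q n t :: nat
  assumes "q \<in> {2, 3}" and "CARD('a::{field,finite}) = q"
  shows "real (ex_aff TYPE('a) n t)
           < real q powr (real n - (real n - real t) / (sigma q ^ t - real t))
        \<and> (\<forall>(A :: (nat \<Rightarrow> 'a) set) (D :: real).
           A \<subseteq> vecs n \<and> D > 0
           \<and> real (card A) = D * real q powr ((1 - 1 / (sigma q ^ t - real t)) * real n)
         \<longrightarrow> (let N = real q ^ n; \<alpha> = real (card A) / N in
               real (card {S \<in> affine_subspaces n t. S \<subseteq> A})
               > (1 - real q ^ t / D powr (sigma q ^ t - real t))
                 * \<alpha> powr (sigma q ^ t) * N ^ (t + 1)
                 / real (card (Aut_aff t :: ((nat \<Rightarrow> 'a) \<Rightarrow> (nat \<Rightarrow> 'a)) set))))"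
proof (intro conjI allI impI)
  show "real (ex_aff TYPE('a) n t)
      < real q powr (real n - (real n - real t) / (sigma q ^ t - real t))"
    using assms(2,1) by (rule ex_aff_less)
next
  fix A :: "(nat \<Rightarrow> 'a) set" and D :: real
  assume "A \<subseteq> vecs n \<and> D > 0
    \<and> real (card A) = D * real q powr ((1 - 1 / (sigma q ^ t - real t)) * real n)"
  then show "let N = real q ^ n; \<alpha> = real (card A) / N in
      real (card {S \<in> affine_subspaces n t. S \<subseteq> A})
      > (1 - real q ^ t / D powr (sigma q ^ t - real t)) * \<alpha> powr (sigma q ^ t) * N ^ (t + 1)
        / real (card (Aut_aff t :: ((nat \<Rightarrow> 'a) \<Rightarrow> (nat \<Rightarrow> 'a)) set))"
    unfolding Let_def by (elim conjE) (rule affine_subspaces_count_D[OF assms(2,1)])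
qed

end
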